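(* Let $j_X:X\hookrightarrow H_\ell(\tilde X)$, $x\mapsto\bullet_x$, be the natural embedding. Then the quintuple $(H_\ell(\tilde X),\, m_{RT},\, 1,\, \Delta_\epsilon,\, B^+)$ together with $j_X$ is the free cocycle $\epsilon$-unitary Hopf algebra on the set $X$.
   Context: Let $\mathbf{k}$ be a field of characteristic $0$; linear maps and tensor products are over $\mathbf{k}$. For an associative algebra $A$, view $A\otimes A$ as an $A$-bimodule via $a\cdot(b\otimes c):=ab\otimes c$ and $(b\otimes c)\cdot a:=b\otimes ca$. An infinitesimal unitary bialgebra ($\epsilon$-unitary bialgebra) is a quadruple $(A,m,1,\Delta)$ where $(A,m,1)$ is a unitary associative algebra, $(A,\Delta)$ is a coassociative coalgebra (no counit required), and $\Delta(ab)=a\cdot\Delta(b)+\Delta(a)\cdot b$ for all $a,b\in A$. An $\epsilon$-unitary bialgebra morphism is a map that is both a unitary algebra morphism and a coalgebra morphism. On $\mathrm{Hom}_{\mathbf{k}}(A,A)$ the convolution is $f*g=m(f\otimes g)\Delta$ and the circular convolution is $f\circledast g:=f*g+f+g$, for which the zero map is the unit. An $\epsilon$-unitary bialgebra $A$ is an $\epsilon$-unitary Hopf algebra if $\mathrm{id}\in\mathrm{Hom}_{\mathbf{k}}(A,A)$ is invertible with respect to $\circledast$; its inverse $S$ is called the antipode. An $\epsilon$-unitary Hopf algebra morphism $\phi:H\to L$ is an $\epsilon$-unitary bialgebra morphism with $S_L\phi=\phi S_H$. An operated $\epsilon$-unitary Hopf algebra $(H,m,1,\Delta,P)$ is an $\epsilon$-unitary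 Hopf algebra with a linear operator $P:H\to H$. A morphism of operated $\epsilon$-unitary Hopf algebras $\phi:(H,P_H)\to(L,P_L)$ is an $\epsilon$-unitary Hopf algebra morphism with $\phi P_H=P_L\phi$. A cocycle $\epsilon$-unitary Hopf algebra is an operated $\epsilon$-unitary Hopf algebra with $\Delta P=\mathrm{id}\otimes 1+(\mathrm{id}\otimes P)\Delta$, i.e. $\Delta(P(a))=a\otimes 1+(\mathrm{id}\otimes P)\Delta(a)$ for all $a\in H$. The free cocycle $\epsilon$-unitary Hopf algebra on a set $X$ is a cocycle $\epsilon$-unitary Hopf algebra $(H_X,m_X,1_X,\Delta_X,P_X)$ together with a set map $j_X:X\to H_X$ such that, for any cocycle $\epsilon$-unitary Hopf algebra $(H,m,1,\Delta,P)$ and any set map $f:X\to H$ with $\Delta(f(x))=1\otimes 1$ for all $x\in X$, there is a unique morphism $\bar f:H_X\to H$ of operated $\epsilon$-unitary Hopf algebras with $\bar f j_X=f$. Let $X$ be a set, $\sigma\notin X$ a symbol, and $\tilde X:=X\sqcup\{\sigma\}$. Consider planar rooted trees whose vertices are decorated by elements of $\tilde X$ in such a way that elements of $X$ decorate leaves only (all internal vertices, and possibly some leaves, are decorated by $\sigma$; the vertex of a one-vertex tree counts as a leaf). Let $\mathcal{T}_\ell(\tilde X)$ be the set of such trees, including by convention the empty tree $1$. Let $\mathcal{F}_\ell(\tilde X)$ be the free monoid generated by the nonempty such trees (planar decorated rooted forests, with concatenation as product and $1$ as identity), and let $H_\ell(\tilde X):=\mathbf{k}\mathcal{F}_\ell(\tilde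 X)$ be the $\mathbf{k}$-vector space with basis $\mathcal{F}_\ell(\tilde X)$, with the linearly extended concatenation product $m_{RT}$ and unit $1$. For $x\in\tilde X$, $\bullet_x$ is the one-vertex tree decorated by $x$. $B^+:H_\ell(\tilde X)\to H_\ell(\tilde X)$ is the linear grafting map with $B^+(1)=\bullet_\sigma$ that sends a forest to the tree obtained by grafting it onto a new root decorated by $\sigma$. Every nonempty tree in $\mathcal{T}_\ell(\tilde X)$ is either $\bullet_x$ with $x\in X$ or $B^+(\bar F)$ for a unique forest $\bar F\in\mathcal{F}_\ell(\tilde X)$. The linear map $\Delta_\epsilon:H_\ell(\tilde X)\to H_\ell(\tilde X)\otimes H_\ell(\tilde X)$ is defined recursively on forests by: $\Delta_\epsilon(1)=0$; $\Delta_\epsilon(\bullet_x)=1\otimes 1$ for $x\in X$; $\Delta_\epsilon(B^+(\bar F))=\bar F\otimes 1+(\mathrm{id}\otimes B^+)\Delta_\epsilon(\bar F)$ for $\bar F\in\mathcal{F}_\ell(\tilde X)$; and $\Delta_\epsilon(T_1T_2\cdots T_m)=T_1\cdot\Delta_\epsilon(T_2\cdots T_m)+\Delta_\epsilon(T_1)\cdot(T_2\cdots T_m)$ for nonempty trees $T_1,\dots,T_m\in\mathcal{T}_\ell(\tilde X)$, $m\ge 2$. *)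

theory Defs
  imports Complex_Main "HOL-Library.Poly_Mapping" "HOL-Library.FuncSet"
begin

section \<open>Formal linear combinations\<close>

definition fscale :: "'k::field \<Rightarrow> ('b \<Rightarrow>\<^sub>0 'k) \<Rightarrow> ('b \<Rightarrow>\<^sub>0 'k)" where
  "fscale c p = Poly_Mapping.map ((*) c) p"

abbreviation basis :: "'b \<Rightarrow> ('b \<Rightarrow>\<^sub>0 'k::field)" where
  "basis b \<equiv> Poly_Mapping.single b 1"

text \<open>The linear extension of a map \<open>g\<close> from basis elements to a vector space whose scalar
  multiplication is \<open>s\<close>.\<close>

definition linext :: "('k::field \<Rightarrow> 'v::ab_group_add \<Rightarrow> 'v) \<Rightarrow> ('b \<Rightarrow> 'v) \<Rightarrow> ('b \<Rightarrow>\<^sub>0 'k) \<Rightarrow> 'v" where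
  "linext s g p = (\<Sum>b\<in>Poly_Mapping.keys p. s (Poly_Mapping.lookup p b) (g b))"

lemma lookup_fscale [simp]: "Poly_Mapping.lookup (fscale c p) b = c * Poly_Mapping.lookup p b"
  by (simp add: fscale_def Poly_Mapping.map.rep_eq when_def)

lemma vector_space_fscale: "vector_space (fscale :: 'k::field \<Rightarrow> ('b \<Rightarrow>\<^sub>0 'k) \<Rightarrow> _)"
  by unfold_locales (auto intro!: poly_mapping_eqI simp: lookup_add algebra_simps)

section \<open>Unitary algebras\<close>

text \<open>The carrier of an algebra is a subset of a type that carries the ring operations; the whole
  type is a possible carrier. The sort \<open>{ring, monoid_mult}\<close> (unlike \<open>ring_1\<close>) allows \<open>0 = 1\<close>, so
  that the zero algebra is included.\<close>

record ('k, 'a) alg =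
  carr :: "'a set"
  scal :: "'k \<Rightarrow> 'a \<Rightarrow> 'a"

definition unitary_algebra :: "('k::field, 'a::{ring,monoid_mult}, 'z) alg_scheme \<Rightarrow> bool" where
  "unitary_algebra A \<longleftrightarrow>
     vector_space (scal A) \<and> module.subspace (scal A) (carr A) \<and>
     1 \<in> carr A \<and> (\<forall>a\<in>carr A. \<forall>b\<in>carr A. a * b \<in> carr A) \<and>
     (\<forall>c. \<forall>a\<in>carr A. \<forall>b\<in>carr A. scal A c (a * b) = scal A c a * b \<and> scal A c (a * b) = a * scal A c b)"

definition linear_hom ::
  "('k::field, 'a::ab_group_add, 'y) alg_scheme \<Rightarrow> ('k, 'b::ab_group_add, 'z) alg_scheme \<Rightarrow> ('a \<Rightarrow> 'b) \<Rightarrow> bool" where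
  "linear_hom A B f \<longleftrightarrow>
     f \<in> carr A \<rightarrow> carr B \<and>
     (\<forall>a\<in>carr A. \<forall>b\<in>carr A. f (a + b) = f a + f b) \<and>
     (\<forall>c. \<forall>a\<in>carr A. f (scal A c a) = scal B c (f a))"

section \<open>Tensor products\<close>

text \<open>\<open>A \<otimes> A\<close> is the quotient of the space of formal linear combinations of pairs from \<open>carr A\<close>
  by the subspace spanned by the bilinearity relations, and \<open>A \<otimes> A \<otimes> A\<close> the analogous quotient
  for triples. A tensor is a coset; linear maps out of a tensor product are given by
  evaluating the corresponding linear map of formal sums at a representative (the value does
  not depend on the representative, since the relations are respected).\<close>

type_synonym ('a, 'k) tensor2 = "('a \<times> 'a \<Rightarrow>\<^sub>0 'k) set"
type_synonym ('a, 'k) tensor3 = "('a \<times> 'a \<times> 'a \<Rightarrow>\<^sub>0 'k) set"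

definition bilin_rels :: "('k::field, 'a::ab_group_add, 'z) alg_scheme \<Rightarrow> ('a \<times> 'a \<Rightarrow>\<^sub>0 'k) set" where
  "bilin_rels A =
     {basis (a + a', b) - basis (a, b) - basis (a', b) | a a' b. a \<in> carr A \<and> a' \<in> carr A \<and> b \<in> carr A} \<union>
     {basis (a, b + b') - basis (a, b) - basis (a, b') | a b b'. a \<in> carr A \<and> b \<in> carr A \<and> b' \<in> carr A} \<union>
     {basis (scal A c a, b) - fscale c (basis (a, b)) | c a b. a \<in> carr A \<and> b \<in> carr A} \<union>
     {basis (a, scal A c b) - fscale c (basis (a, b)) | c a b. a \<in> carr A \<and> b \<in> carr A}"

definition trilin_rels :: "('k::field, 'a::ab_group_add, 'z) alg_scheme \<Rightarrow> ('a \<times> 'a \<times> 'a \<Rightarrow>\<^sub>0 'k) set" where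
  "trilin_rels A =
     {basis (a + a', b, d) - basis (a, b, d) - basis (a', b, d) | a a' b d.
        a \<in> carr A \<and> a' \<in> carr A \<and> b \<in> carr A \<and> d \<in> carr A} \<union>
     {basis (a, b + b', d) - basis (a, b, d) - basis (a, b', d) | a b b' d.
        a \<in> carr A \<and> b \<in> carr A \<and> b' \<in> carr A \<and> d \<in> carr A} \<union>
     {basis (a, b, d + d') - basis (a, b, d) - basis (a, b, d') | a b d d'.
        a \<in> carr A \<and> b \<in> carr A \<and> d \<in> carr A \<and> d' \<in> carr A} \<union>
     {basis (scal A c a, b, d) - fscale c (basis (a, b, d)) | c a b d.
        a \<in> carr A \<and> b \<in> carr A \<and> d \<in> carr A} \<union>
     {basis (a, scal A c b, d) - fscale c (basis (a, b, d)) | c a b d.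
        a \<in> carr A \<and> b \<in> carr A \<and> d \<in> carr A} \<union>
     {basis (a, b, scal A c d) - fscale c (basis (a, b, d)) | c a b d.
        a \<in> carr A \<and> b \<in> carr A \<and> d \<in> carr A}"

definition cls2 :: "('k::field, 'a::ab_group_add, 'z) alg_scheme \<Rightarrow> ('a \<times> 'a \<Rightarrow>\<^sub>0 'k) \<Rightarrow> ('a, 'k) tensor2" where
  "cls2 A t = {u. u - t \<in> module.span fscale (bilin_rels A)}"

definition cls3 ::
  "('k::field, 'a::ab_group_add, 'z) alg_scheme \<Rightarrow> ('a \<times> 'a \<times> 'a \<Rightarrow>\<^sub>0 'k) \<Rightarrow> ('a, 'k) tensor3" where
  "cls3 A t = {u. u - t \<in> module.span fscale (trilin_rels A)}"

definition tensor2_carr :: "('k::field, 'a::ab_group_add, 'z) alg_scheme \<Rightarrow> ('a, 'k) tensor2 set" where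
  "tensor2_carr A = cls2 A ` {t. Poly_Mapping.keys t \<subseteq> carr A \<times> carr A}"

definition rep :: "'t set \<Rightarrow> 't" where
  "rep T = (SOME t. t \<in> T)"

lemma rep_cls2:
  fixes A :: "('k::field, 'a::ab_group_add, 'z) alg_scheme"
  shows "rep (cls2 A t) \<in> cls2 A t"
proof -
  interpret vector_space "fscale :: 'k \<Rightarrow> ('a \<times> 'a \<Rightarrow>\<^sub>0 'k) \<Rightarrow> _" by (rule vector_space_fscale)
  have "t \<in> cls2 A t" by (simp add: cls2_def span_zero)
  then show ?thesis unfolding rep_def by (rule someI)
qed

lemma cls2_eq_iff:
  fixes A :: "('k::field, 'a::ab_group_add, 'z) alg_scheme"
  shows "cls2 A t = cls2 A u \<longleftrightarrow> t - u \<in> module.span fscale (bilin_rels A)"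
proof -
  interpret vector_space "fscale :: 'k \<Rightarrow> ('a \<times> 'a \<Rightarrow>\<^sub>0 'k) \<Rightarrow> _" by (rule vector_space_fscale)
  show ?thesis
  proof
    assume "cls2 A t = cls2 A u"
    moreover have "t \<in> cls2 A t" by (simp add: cls2_def span_zero)
    ultimately show "t - u \<in> span (bilin_rels A)" by (simp add: cls2_def)
  next
    assume *: "t - u \<in> span (bilin_rels A)"
    have "w - t \<in> span (bilin_rels A) \<longleftrightarrow> w - u \<in> span (bilin_rels A)" for w
      using span_add[of "w - t" "bilin_rels A" "t - u"] span_diff[of "w - u" "bilin_rels A" "t - u"] *
      by (auto simp: algebra_simps)
    then show "cls2 A t = cls2 A u" by (auto simp: cls2_def)
  qed
qed

definition pure :: "('k::field, 'a::ab_group_add, 'z) alg_scheme \<Rightarrow> 'a \<Rightarrow> 'a \<Rightarrow> ('a, 'k) tensor2" where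
  "pure A a b = cls2 A (basis (a, b))"

definition tadd ::
  "('k::field, 'a::ab_group_add, 'z) alg_scheme \<Rightarrow> ('a, 'k) tensor2 \<Rightarrow> ('a, 'k) tensor2 \<Rightarrow> ('a, 'k) tensor2" where
  "tadd A T U = cls2 A (rep T + rep U)"

definition tscale ::
  "('k::field, 'a::ab_group_add, 'z) alg_scheme \<Rightarrow> 'k \<Rightarrow> ('a, 'k) tensor2 \<Rightarrow> ('a, 'k) tensor2" where
  "tscale A c T = cls2 A (fscale c (rep T))"

text \<open>\<open>tmap B f g\<close> is \<open>f \<otimes> g : A \<otimes> A \<rightarrow> B \<otimes> B\<close> for linear maps \<open>f, g : A \<rightarrow> B\<close>.\<close>

definition tmap ::
  "('k::field, 'b::ab_group_add, 'z) alg_scheme \<Rightarrow> ('a \<Rightarrow> 'b) \<Rightarrow> ('a \<Rightarrow> 'b) \<Rightarrow> ('a, 'k) tensor2 \<Rightarrow> ('b, 'k) tensor2" where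
  "tmap B f g T = cls2 B (linext fscale (\<lambda>(a, b). basis (f a, g b)) (rep T))"

definition lact ::
  "('k::field, 'a::ring, 'z) alg_scheme \<Rightarrow> 'a \<Rightarrow> ('a, 'k) tensor2 \<Rightarrow> ('a, 'k) tensor2" where
  "lact A a T = tmap A (\<lambda>b. a * b) (\<lambda>c. c) T"

definition ract ::
  "('k::field, 'a::ring, 'z) alg_scheme \<Rightarrow> ('a, 'k) tensor2 \<Rightarrow> 'a \<Rightarrow> ('a, 'k) tensor2" where
  "ract A T a = tmap A (\<lambda>b. b) (\<lambda>c. c * a) T"

section \<open>Infinitesimal unitary bialgebras and Hopf algebras\<close>

record (overloaded) ('k::zero, 'a) bialg = "('k, 'a) alg" +
  comult :: "'a \<Rightarrow> ('a, 'k) tensor2"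

definition comult_id ::
  "('k::field, 'a::ab_group_add, 'z) bialg_scheme \<Rightarrow> ('a, 'k) tensor2 \<Rightarrow> ('a, 'k) tensor3" where
  "comult_id A T = cls3 A (linext fscale
     (\<lambda>(a, b). linext fscale (\<lambda>(x, y). basis (x, y, b)) (rep (comult A a))) (rep T))"

definition id_comult ::
  "('k::field, 'a::ab_group_add, 'z) bialg_scheme \<Rightarrow> ('a, 'k) tensor2 \<Rightarrow> ('a, 'k) tensor3" where
  "id_comult A T = cls3 A (linext fscale
     (\<lambda>(a, b). linext fscale (\<lambda>(x, y). basis (a, x, y)) (rep (comult A b))) (rep T))"

definition coassociative_coalgebra :: "('k::field, 'a::ab_group_add, 'z) bialg_scheme \<Rightarrow> bool" where
  "coassociative_coalgebra A \<longleftrightarrow>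
     comult A \<in> carr A \<rightarrow> tensor2_carr A \<and>
     (\<forall>a\<in>carr A. \<forall>b\<in>carr A. comult A (a + b) = tadd A (comult A a) (comult A b)) \<and>
     (\<forall>c. \<forall>a\<in>carr A. comult A (scal A c a) = tscale A c (comult A a)) \<and>
     (\<forall>a\<in>carr A. comult_id A (comult A a) = id_comult A (comult A a))"

definition eps_bialgebra :: "('k::field, 'a::{ring,monoid_mult}, 'z) bialg_scheme \<Rightarrow> bool" where
  "eps_bialgebra A \<longleftrightarrow>
     unitary_algebra A \<and> coassociative_coalgebra A \<and>
     (\<forall>a\<in>carr A. \<forall>b\<in>carr A.
        comult A (a * b) = tadd A (lact A a (comult A b)) (ract A (comult A a) b))"

definition eps_bialgebra_morphism ::
  "('k::field, 'a::{ring,monoid_mult}, 'y) bialg_scheme \<Rightarrow>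
   ('k, 'b::{ring,monoid_mult}, 'z) bialg_scheme \<Rightarrow> ('a \<Rightarrow> 'b) \<Rightarrow> bool" where
  "eps_bialgebra_morphism A B \<phi> \<longleftrightarrow>
     linear_hom A B \<phi> \<and> \<phi> 1 = 1 \<and>
     (\<forall>a\<in>carr A. \<forall>b\<in>carr A. \<phi> (a * b) = \<phi> a * \<phi> b) \<and>
     (\<forall>a\<in>carr A. comult B (\<phi> a) = tmap B \<phi> \<phi> (comult A a))"

definition conv ::
  "('k::field, 'a::ring, 'z) bialg_scheme \<Rightarrow> ('a \<Rightarrow> 'a) \<Rightarrow> ('a \<Rightarrow> 'a) \<Rightarrow> 'a \<Rightarrow> 'a" where
  "conv A f g a = linext (scal A) (\<lambda>(x, y). f x * g y) (rep (comult A a))"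

definition circ_conv ::
  "('k::field, 'a::ring, 'z) bialg_scheme \<Rightarrow> ('a \<Rightarrow> 'a) \<Rightarrow> ('a \<Rightarrow> 'a) \<Rightarrow> 'a \<Rightarrow> 'a" where
  "circ_conv A f g a = conv A f g a + f a + g a"

definition is_antipode :: "('k::field, 'a::ring, 'z) bialg_scheme \<Rightarrow> ('a \<Rightarrow> 'a) \<Rightarrow> bool" where
  "is_antipode A S \<longleftrightarrow>
     linear_hom A A S \<and>
     (\<forall>a\<in>carr A. circ_conv A (\<lambda>x. x) S a = 0 \<and> circ_conv A S (\<lambda>x. x) a = 0)"

definition eps_hopf_algebra :: "('k::field, 'a::{ring,monoid_mult}, 'z) bialg_scheme \<Rightarrow> bool" where
  "eps_hopf_algebra A \<longleftrightarrow> eps_bialgebra A \<and> (\<exists>S. is_antipode A S)"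

text \<open>\<open>extensional\<close> makes the antipode, which is determined on the carrier only, unique as a
  function on the type.\<close>

definition antipode :: "('k::field, 'a::ring, 'z) bialg_scheme \<Rightarrow> 'a \<Rightarrow> 'a" where
  "antipode A = (THE S. S \<in> extensional (carr A) \<and> is_antipode A S)"

definition eps_hopf_morphism ::
  "('k::field, 'a::{ring,monoid_mult}, 'y) bialg_scheme \<Rightarrow>
   ('k, 'b::{ring,monoid_mult}, 'z) bialg_scheme \<Rightarrow> ('a \<Rightarrow> 'b) \<Rightarrow> bool" where
  "eps_hopf_morphism A B \<phi> \<longleftrightarrow>
     eps_bialgebra_morphism A B \<phi> \<and> (\<forall>a\<in>carr A. antipode B (\<phi> a) = \<phi> (antipode A a))"

section \<open>Operated and cocycle Hopf algebras\<close>

record (overloaded) ('k::zero, 'a) opalg = "('k, 'a) bialg" +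
  oper :: "'a \<Rightarrow> 'a"

definition operated_eps_hopf_algebra :: "('k::field, 'a::{ring,monoid_mult}, 'z) opalg_scheme \<Rightarrow> bool" where
  "operated_eps_hopf_algebra A \<longleftrightarrow> eps_hopf_algebra A \<and> linear_hom A A (oper A)"

definition operated_eps_hopf_morphism ::
  "('k::field, 'a::{ring,monoid_mult}, 'y) opalg_scheme \<Rightarrow>
   ('k, 'b::{ring,monoid_mult}, 'z) opalg_scheme \<Rightarrow> ('a \<Rightarrow> 'b) \<Rightarrow> bool" where
  "operated_eps_hopf_morphism A B \<phi> \<longleftrightarrow>
     eps_hopf_morphism A B \<phi> \<and> (\<forall>a\<in>carr A. \<phi> (oper A a) = oper B (\<phi> a))"

definition cocycle_eps_hopf_algebra :: "('k::field, 'a::{ring,monoid_mult}, 'z) opalg_scheme \<Rightarrow> bool" where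
  "cocycle_eps_hopf_algebra A \<longleftrightarrow>
     operated_eps_hopf_algebra A \<and>
     (\<forall>a\<in>carr A. comult A (oper A a) = tadd A (pure A a 1) (tmap A (\<lambda>x. x) (oper A) (comult A a)))"

text \<open>The target of the universal property ranges over all algebras carried by a subset of the type
  \<open>'h\<close>, which is passed as an argument; it is a type variable in the final statement. Uniqueness of
  the induced morphism is uniqueness on the carrier, hence the restriction to \<open>extensional\<close> functions.\<close>

definition free_cocycle_eps_hopf_algebra ::
  "'h::{ring,monoid_mult} itself \<Rightarrow> 'x set \<Rightarrow>
   ('k::field, 'a::{ring,monoid_mult}) opalg \<Rightarrow> ('x \<Rightarrow> 'a) \<Rightarrow> bool" where
  "free_cocycle_eps_hopf_algebra (_ :: 'h itself) X A j \<longleftrightarrow>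
     cocycle_eps_hopf_algebra A \<and> j \<in> X \<rightarrow> carr A \<and>
     (\<forall>(H :: ('k, 'h) opalg) f.
        cocycle_eps_hopf_algebra H \<and> f \<in> X \<rightarrow> carr H \<and> (\<forall>x\<in>X. comult H (f x) = pure H 1 1) \<longrightarrow>
        (\<exists>!\<phi>. \<phi> \<in> extensional (carr A) \<and> operated_eps_hopf_morphism A H \<phi> \<and> (\<forall>x\<in>X. \<phi> (j x) = f x)))"

section \<open>Decorated planar rooted forests\<close>

text \<open>Decorations have type \<open>'x option\<close>; \<open>None\<close> is the extra symbol \<open>\<sigma>\<close>. The empty tree is the empty
  forest \<open>[]\<close>.\<close>

datatype 'd tree = Node 'd "'d tree list"

type_synonym 'x forest = "'x option tree list"

fun leaf_decorated :: "'x set \<Rightarrow> 'x option tree \<Rightarrow> bool" where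
  "leaf_decorated X (Node d ts) \<longleftrightarrow>
     d \<in> insert None (Some ` X) \<and> (ts \<noteq> [] \<longrightarrow> d = None) \<and> (\<forall>t\<in>set ts. leaf_decorated X t)"

definition forests :: "'x set \<Rightarrow> 'x forest set" where
  "forests X = lists {t. leaf_decorated X t}"

text \<open>The free monoid, written additively because the convolution product of \<open>Poly_Mapping\<close>
  expects an additive monoid of exponents: the ring \<open>'x forest \<Rightarrow>\<^sub>0 'k\<close> then has concatenation of
  forests as product and \<open>basis []\<close> as unit.\<close>

instantiation list :: (type) monoid_add
begin
definition zero_list :: "'a list" where "zero_list = []"
definition plus_list :: "'a list \<Rightarrow> 'a list \<Rightarrow> 'a list" where "plus_list xs ys = xs @ ys"
instance by intro_classes (simp_all add: zero_list_def plus_list_def)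
end

lemma basis_times_basis: "(basis F * basis G :: 'a list \<Rightarrow>\<^sub>0 'k::field) = basis (F @ G)"
  by (simp add: Poly_Mapping.mult_single plus_list_def)

lemma one_eq_basis: "(1 :: 'a list \<Rightarrow>\<^sub>0 'k::field) = basis []"
  by (simp add: zero_list_def flip: Poly_Mapping.single_one)

definition H_alg :: "'x set \<Rightarrow> ('k::field, 'x forest \<Rightarrow>\<^sub>0 'k) alg" where
  "H_alg X = \<lparr>carr = {p. Poly_Mapping.keys p \<subseteq> forests X}, scal = fscale\<rparr>"

definition bullet :: "'x \<Rightarrow> ('x forest \<Rightarrow>\<^sub>0 'k::field)" where
  "bullet x = basis [Node (Some x) []]"

definition Bplus :: "('x forest \<Rightarrow>\<^sub>0 'k::field) \<Rightarrow> ('x forest \<Rightarrow>\<^sub>0 'k)" where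
  "Bplus = linext fscale (\<lambda>F. basis [Node None F])"

text \<open>In the second equation only \<open>ts = []\<close> is relevant: elements of \<open>X\<close> decorate leaves only.\<close>

fun Delta_forest :: "'x set \<Rightarrow> 'x forest \<Rightarrow> ('x forest \<Rightarrow>\<^sub>0 'k::field, 'k) tensor2" where
  "Delta_forest X [] = cls2 (H_alg X) 0"
| "Delta_forest X [Node (Some x) ts] = pure (H_alg X) 1 1"
| "Delta_forest X [Node None F] =
     tadd (H_alg X) (pure (H_alg X) (basis F) 1) (tmap (H_alg X) (\<lambda>p. p) Bplus (Delta_forest X F))"
| "Delta_forest X (t # u # ts) =
     tadd (H_alg X) (lact (H_alg X) (basis [t]) (Delta_forest X (u # ts)))
                    (ract (H_alg X) (Delta_forest X [t]) (basis (u # ts)))"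

definition Delta_eps :: "'x set \<Rightarrow> ('x forest \<Rightarrow>\<^sub>0 'k::field) \<Rightarrow> ('x forest \<Rightarrow>\<^sub>0 'k, 'k) tensor2" where
  "Delta_eps X p = cls2 (H_alg X) (linext fscale (\<lambda>F. rep (Delta_forest X F)) p)"

definition H_forests :: "'x set \<Rightarrow> ('k::field, 'x forest \<Rightarrow>\<^sub>0 'k) opalg" where
  "H_forests X =
     \<lparr>carr = carr (H_alg X :: ('k, 'x forest \<Rightarrow>\<^sub>0 'k) alg), scal = scal (H_alg X),
      comult = Delta_eps X, oper = Bplus\<rparr>"

end

theory Submission
  imports Defs
begin

text \<open>By induction on forests, \<open>\<Delta>\<^sub>\<epsilon>(F)\<close> is the sum of \<open>a \<otimes> b\<close> over an explicit list of pairs of forests, with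
  \<open>a\<close> and \<open>b\<close> both having fewer vertices than \<open>F\<close>. Coassociativity becomes an identity of finite sums
  over forests, and the circular inverse of the identity exists by recursion on the number of
  vertices. The derivation rule and the cocycle condition are inductive descriptions of \<open>\<Delta>\<close> on
  products and on \<open>P(a)\<close>, so the unique operated algebra map extending \<open>f\<close> is a coalgebra map.
  It preserves antipodes because convolution inverses are unique.\<close>

section \<open>Linear extension\<close>

text \<open>The combinatorics is short. Deleting a vertex v of a decorated forest leaves what
  precedes v and what follows v in postorder, and the coproduct sums these pairs over all v;
  coassociativity amounts to deleting two vertices in either order. The obstacle is the tensor
  product. A tensor is a coset, operations on tensors pick an arbitrary representative, and algebras
  live on a subset of a type, so nothing is known about a map off its carrier. Hence representatives
  are shown to be supported on carrier elements, and maps on formal sums are compared modulo the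
  span of the relations. The lift \<open>cop\<close> of the coproduct to formal sums is exactly
  linear, so coassociativity holds there before passing to cosets. The derivation rule and the
  cocycle condition involve symbols such as \<open>basis (p * a, b)\<close>, linear in
  \<open>p\<close> only modulo the relations: they are exact on forests and extended from there
  modulo the span. There is no counit and hence no convolution unit to work with, so uniqueness of
  circular inverses is derived from associativity alone.\<close>

context vector_space
begin

lemma linext_superset:
  assumes "finite K" "Poly_Mapping.keys p \<subseteq> K"
  shows "linext scale g p = (\<Sum>b\<in>K. scale (Poly_Mapping.lookup p b) (g b))"
  unfolding linext_def using assms
  by (intro sum.mono_neutral_left) (auto simp: in_keys_iff)

lemma linext_zero [simp]: "linext scale g 0 = 0"
  by (simp add: linext_def)

lemma linext_basis [simp]: "linext scale g (basis b) = g b"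
  by (simp add: linext_def)

lemma linext_add: "linext scale g (p + q) = linext scale g p + linext scale g q"
proof -
  let ?K = "Poly_Mapping.keys p \<union> Poly_Mapping.keys q"
  show ?thesis
    using linext_superset[of ?K "p + q" g] linext_superset[of ?K p g] linext_superset[of ?K q g]
      keys_add[of p q]
    by (simp add: lookup_add scale_left_distrib sum.distrib)
qed

lemma linext_fscale: "linext scale g (fscale c p) = scale c (linext scale g p)"
proof -
  have "Poly_Mapping.keys (fscale c p) \<subseteq> Poly_Mapping.keys p"
    by (auto simp: in_keys_iff)
  from linext_superset[OF finite_keys this, of g] show ?thesis
    by (simp add: linext_def scale_sum_right)
qed

lemma linext_uminus: "linext scale g (- p) = - linext scale g p"
  using linext_add[of g p "- p"] by (simp add: add_eq_0_iff)

lemma linext_diff: "linext scale g (p - q) = linext scale g p - linext scale g q"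
  using linext_add[of g p "- q"] by (simp add: linext_uminus)

lemma linext_sum_list: "linext scale g (\<Sum>x\<leftarrow>xs. f x) = (\<Sum>x\<leftarrow>xs. linext scale g (f x))"
  by (induction xs) (simp_all add: linext_add)

lemma linext_in_subspace:
  assumes "subspace W" "\<And>b. b \<in> Poly_Mapping.keys p \<Longrightarrow> g b \<in> W"
  shows "linext scale g p \<in> W"
  unfolding linext_def using assms by (intro subspace_sum subspace_scale) auto

lemma linext_fun_uminus: "linext scale (\<lambda>b. - g b) p = - linext scale g p"
  by (simp add: linext_def sum_negf)

lemma linext_fun_diff:
  "linext scale (\<lambda>b. g b - h b) p = linext scale g p - linext scale h p"
  by (simp add: linext_def scale_right_diff_distrib sum_subtractf)

lemma linext_fun_scale: "linext scale (\<lambda>b. scale c (g b)) p = scale c (linext scale g p)"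
  by (simp add: linext_def scale_sum_right mult.commute)

end

lemma linext_cong:
  "p = q \<Longrightarrow> (\<And>b. b \<in> Poly_Mapping.keys q \<Longrightarrow> g b = h b) \<Longrightarrow> linext s g p = linext s h q"
  by (simp add: linext_def)

global_interpretation fs: vector_space "fscale :: 'k::field \<Rightarrow> ('b \<Rightarrow>\<^sub>0 'k) \<Rightarrow> _"
  by (rule vector_space_fscale)

lemma linext_fscale_basis [simp]: "linext fscale basis p = p"
proof (rule poly_mapping_eqI)
  fix k
  have "Poly_Mapping.lookup (linext fscale basis p) k
      = (\<Sum>b\<in>Poly_Mapping.keys p. Poly_Mapping.lookup p b * (1 when b = k))"
    by (simp add: linext_def lookup_sum lookup_single)
  also have "\<dots> = Poly_Mapping.lookup p k"
    by (simp add: when_def in_keys_iff if_distrib[of "(*) _"] cong: if_cong)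
  finally show "Poly_Mapping.lookup (linext fscale basis p) k = Poly_Mapping.lookup p k" .
qed

lemma (in vector_space) linext_linext:
  "linext scale g (linext fscale h p) = linext scale (\<lambda>b. linext scale g (h b)) p"
proof -
  have "linext scale g (\<Sum>b\<in>K. fscale (c b) (h b)) = (\<Sum>b\<in>K. scale (c b) (linext scale g (h b)))"
    if "finite K" for K c
    using that by induction (simp_all add: linext_add linext_fscale)
  from this[OF finite_keys] show ?thesis
    by (simp add: linext_def[of _ h] linext_def[of _ "\<lambda>b. linext scale g (h b)"])
qed

lemma subspace_keys_subset: "fs.subspace {p :: 'a \<Rightarrow>\<^sub>0 'b::field. Poly_Mapping.keys p \<subseteq> K}"
proof (rule fs.subspaceI)
  show "x + y \<in> {p. Poly_Mapping.keys p \<subseteq> K}"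
    if "x \<in> {p. Poly_Mapping.keys p \<subseteq> K}" "y \<in> {p. Poly_Mapping.keys p \<subseteq> K}"
    for x y :: "'a \<Rightarrow>\<^sub>0 'b"
    using that keys_add[of x y] by auto
qed (auto simp: in_keys_iff)

lemma keys_linext_subset:
  "(\<And>b. b \<in> Poly_Mapping.keys p \<Longrightarrow> Poly_Mapping.keys (g b) \<subseteq> K) \<Longrightarrow>
   Poly_Mapping.keys (linext fscale g p) \<subseteq> K"
  using fs.linext_in_subspace[OF subspace_keys_subset, of p g K] by simp

section \<open>Linear and bilinear maps modulo a subspace\<close>

text \<open>Taking for \<open>W\<close> the span of the bilinearity or trilinearity relations, maps into tensor products
  become maps into formal sums that are linear up to \<open>W\<close>; taking \<open>W = {0}\<close> gives ordinary linear maps.\<close>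

definition linear_space :: "('k::field, 'a::ab_group_add, 'z) alg_scheme \<Rightarrow> bool" where
  "linear_space A \<longleftrightarrow> vector_space (scal A) \<and> module.subspace (scal A) (carr A)"

lemma linear_spaceD:
  assumes "linear_space A"
  shows "vector_space (scal A)" "0 \<in> carr A"
    "a \<in> carr A \<Longrightarrow> b \<in> carr A \<Longrightarrow> a + b \<in> carr A"
    "a \<in> carr A \<Longrightarrow> scal A c a \<in> carr A"
proof -
  interpret vector_space "scal A" using assms by (simp add: linear_space_def)
  show "vector_space (scal A)" by (rule vector_space_axioms)
  have "subspace (carr A)" using assms by (simp add: linear_space_def)
  then show "0 \<in> carr A" "a \<in> carr A \<Longrightarrow> b \<in> carr A \<Longrightarrow> a + b \<in> carr A"
    "a \<in> carr A \<Longrightarrow> scal A c a \<in> carr A"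
    by (simp_all add: subspace_def)
qed

definition linear_modulo ::
  "('k::field, 'a::ab_group_add, 'z) alg_scheme \<Rightarrow> ('k \<Rightarrow> 'v \<Rightarrow> 'v) \<Rightarrow> 'v::ab_group_add set \<Rightarrow> ('a \<Rightarrow> 'v) \<Rightarrow> bool" where
  "linear_modulo A s W g \<longleftrightarrow>
     (\<forall>a\<in>carr A. \<forall>b\<in>carr A. g (a + b) - g a - g b \<in> W) \<and>
     (\<forall>c. \<forall>a\<in>carr A. g (scal A c a) - s c (g a) \<in> W)"

definition bilinear_modulo ::
  "('k::field, 'a::ab_group_add, 'z) alg_scheme \<Rightarrow> ('k \<Rightarrow> 'v \<Rightarrow> 'v) \<Rightarrow> 'v::ab_group_add set \<Rightarrow> ('a \<Rightarrow> 'a \<Rightarrow> 'v) \<Rightarrow> bool" where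
  "bilinear_modulo A s W \<beta> \<longleftrightarrow>
     (\<forall>b\<in>carr A. linear_modulo A s W (\<lambda>a. \<beta> a b)) \<and> (\<forall>a\<in>carr A. linear_modulo A s W (\<beta> a))"

text \<open>The formal sums sent into \<open>W\<close> form a subspace, and bilinearity modulo
  \<open>W\<close> says that this subspace contains every generating relation.\<close>

lemma linext_bilin_rels:
  fixes A :: "('k::field, 'a::ab_group_add, 'z) alg_scheme"
  assumes "vector_space s" "module.subspace s W" "bilinear_modulo A s W \<beta>"
    and "t \<in> fs.span (bilin_rels A)"
  shows "linext s (\<lambda>(a, b). \<beta> a b) t \<in> W"
proof -
  interpret vector_space s by fact
  let ?L = "linext s (\<lambda>(a, b). \<beta> a b)"
  have "fs.subspace {t. ?L t \<in> W}"
    using assms(2) by (intro fs.subspaceI) (auto simp: linext_add linext_fscale subspace_def)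
  moreover have "bilin_rels A \<subseteq> {t. ?L t \<in> W}"
    using assms(3) unfolding bilinear_modulo_def linear_modulo_def bilin_rels_def
    by (auto simp: linext_diff linext_fscale)
  ultimately show ?thesis using fs.span_minimal assms(4) by blast
qed

lemma linext_bilinear_cong:
  fixes A :: "('k::field, 'a::ab_group_add, 'z) alg_scheme"
  assumes "vector_space s" "module.subspace s W" "bilinear_modulo A s W \<beta>"
    and "t - u \<in> fs.span (bilin_rels A)"
  shows "linext s (\<lambda>(a, b). \<beta> a b) t - linext s (\<lambda>(a, b). \<beta> a b) u \<in> W"
  using linext_bilin_rels[OF assms] vector_space.linext_diff[OF assms(1)] by metis

section \<open>Tensors and their representatives\<close>

text \<open>Two representatives of a tensor differ by such a \<open>t\<close>. So even an
  arbitrarily chosen representative stays inside the domain on which linear maps are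
  controlled.\<close>

lemma keys_bilin_span:
  fixes A :: "('k::field, 'a::ab_group_add, 'z) alg_scheme"
  assumes A: "linear_space A" and t: "t \<in> fs.span (bilin_rels A)"
  shows "Poly_Mapping.keys t \<subseteq> carr A \<times> carr A"
proof -
  have d: "x - y \<in> {p. Poly_Mapping.keys p \<subseteq> carr A \<times> carr A}"
    if "x \<in> {p. Poly_Mapping.keys p \<subseteq> carr A \<times> carr A}"
      "y \<in> {p. Poly_Mapping.keys p \<subseteq> carr A \<times> carr A}" for x y :: "'a \<times> 'a \<Rightarrow>\<^sub>0 'k"
    using that by (rule fs.subspace_diff[OF subspace_keys_subset])
  have s: "fscale c x \<in> {p. Poly_Mapping.keys p \<subseteq> carr A \<times> carr A}"
    if "x \<in> {p. Poly_Mapping.keys p \<subseteq> carr A \<times> carr A}" for c and x :: "'a \<times> 'a \<Rightarrow>\<^sub>0 'k"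
    using that by (rule fs.subspace_scale[OF subspace_keys_subset])
  have b: "basis (a, b) \<in> {p. Poly_Mapping.keys p \<subseteq> carr A \<times> carr A}"
    if "a \<in> carr A" "b \<in> carr A" for a b
    using that by simp
  have "bilin_rels A \<subseteq> {p. Poly_Mapping.keys p \<subseteq> carr A \<times> carr A}"
    unfolding bilin_rels_def
    by (intro Un_least subsetI; elim CollectE exE conjE; hypsubst;
        intro d s b linear_spaceD(3,4)[OF A])
  from fs.span_minimal[OF this subspace_keys_subset] t show ?thesis by blast
qed

lemma rep_cls2_congruent: "rep (cls2 A t) - t \<in> fs.span (bilin_rels A)"
  using rep_cls2[of A t] by (simp add: cls2_def)

lemma keys_rep_cls2:
  assumes "linear_space A" "Poly_Mapping.keys t \<subseteq> carr A \<times> carr A"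
  shows "Poly_Mapping.keys (rep (cls2 A t)) \<subseteq> carr A \<times> carr A"
  using keys_bilin_span[OF assms(1) rep_cls2_congruent[of A t]] assms(2)
    fs.subspace_add[OF subspace_keys_subset[of "carr A \<times> carr A"], of "rep (cls2 A t) - t" t]
  by simp

lemma keys_rep_tensor2:
  "linear_space A \<Longrightarrow> T \<in> tensor2_carr A \<Longrightarrow> Poly_Mapping.keys (rep T) \<subseteq> carr A \<times> carr A"
  using keys_rep_cls2 unfolding tensor2_carr_def by blast

lemma cls2_rep:
  assumes "T \<in> tensor2_carr A"
  shows "cls2 A (rep T) = T"
proof -
  obtain t where "T = cls2 A t" using assms by (auto simp: tensor2_carr_def)
  then show ?thesis using rep_cls2_congruent cls2_eq_iff by metis
qed

lemma linext_rep_cls2: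
  assumes "vector_space s" "bilinear_modulo A s {0} \<beta>"
  shows "linext s (\<lambda>(a, b). \<beta> a b) (rep (cls2 A t)) = linext s (\<lambda>(a, b). \<beta> a b) t"
proof -
  interpret vector_space s by fact
  show ?thesis
    using linext_bilinear_cong[OF assms(1) _ assms(2) rep_cls2_congruent] by (simp add: subspace_def)
qed

lemma tadd_cls2: "tadd A (cls2 A t) (cls2 A u) = cls2 A (t + u)"
proof -
  have "rep (cls2 A t) + rep (cls2 A u) - (t + u) = (rep (cls2 A t) - t) + (rep (cls2 A u) - u)"
    by simp
  also have "\<dots> \<in> fs.span (bilin_rels A)"
    by (intro fs.span_add rep_cls2_congruent)
  finally show ?thesis by (simp add: tadd_def cls2_eq_iff)
qed

lemma tscale_cls2: "tscale A c (cls2 A t) = cls2 A (fscale c t)"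
proof -
  have "fscale c (rep (cls2 A t)) - fscale c t = fscale c (rep (cls2 A t) - t)"
    by (simp add: fs.scale_right_diff_distrib)
  also have "\<dots> \<in> fs.span (bilin_rels A)"
    by (intro fs.span_scale rep_cls2_congruent)
  finally show ?thesis by (simp add: tscale_def cls2_eq_iff)
qed

lemma linear_homD:
  assumes "linear_hom A B f"
  shows "a \<in> carr A \<Longrightarrow> f a \<in> carr B"
    "a \<in> carr A \<Longrightarrow> b \<in> carr A \<Longrightarrow> f (a + b) = f a + f b"
    "a \<in> carr A \<Longrightarrow> f (scal A c a) = scal B c (f a)"
  using assms by (auto simp: linear_hom_def)

lemma bilin_span_basis:
  fixes A :: "('k::field, 'a::ab_group_add, 'z) alg_scheme"
  assumes "a \<in> carr A" "b \<in> carr A"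
  shows "a' \<in> carr A \<Longrightarrow> basis (a + a', b) - basis (a, b) - basis (a', b) \<in> fs.span (bilin_rels A)"
    "b' \<in> carr A \<Longrightarrow> basis (a, b + b') - basis (a, b) - basis (a, b') \<in> fs.span (bilin_rels A)"
    "basis (scal A c a, b) - fscale c (basis (a, b)) \<in> fs.span (bilin_rels A)"
    "basis (a, scal A c b) - fscale c (basis (a, b)) \<in> fs.span (bilin_rels A)"
  by (rule fs.span_base; unfold bilin_rels_def; use assms in blast)+

lemma bilinear_modulo_basis:
  assumes "linear_hom A B f" "linear_hom A B g"
  shows "bilinear_modulo A fscale (fs.span (bilin_rels B)) (\<lambda>a b. basis (f a, g b))"
  unfolding bilinear_modulo_def linear_modulo_def
  using linear_homD[OF assms(1)] linear_homD[OF assms(2)]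
  by (auto intro: bilin_span_basis)

text \<open>Changing the representative changes the image by bilinearity relations of
  \<open>B\<close>. This is what removes \<open>rep\<close> from computations with the two actions
  and with the coproducts.\<close>

lemma tmap_cls2:
  fixes A :: "('k::field, 'a::ab_group_add, 'z) alg_scheme"
  assumes "linear_hom A B f" "linear_hom A B g"
  shows "tmap B f g (cls2 A t) = cls2 B (linext fscale (\<lambda>(a, b). basis (f a, g b)) t)"
  unfolding tmap_def cls2_eq_iff
  by (rule linext_bilinear_cong[OF vector_space_fscale _ bilinear_modulo_basis[OF assms]
        rep_cls2_congruent]) simp

lemma linear_hom_id: "linear_hom A A (\<lambda>x. x)"
  by (simp add: linear_hom_def)

lemma linear_hom_compose:
  "linear_hom A B f \<Longrightarrow> linear_hom B C g \<Longrightarrow> linear_hom A C (\<lambda>x. g (f x))"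
  by (auto simp: linear_hom_def Pi_iff)

lemma linear_hom_restrict:
  assumes "linear_space A" "linear_hom A B f"
  shows "linear_hom A B (restrict f (carr A))"
  using assms(2) linear_spaceD(3,4)[OF assms(1)] by (auto simp: linear_hom_def)

section \<open>Unitary algebras and linear combinations inside a carrier\<close>

lemma unitary_algebraD:
  assumes "unitary_algebra A"
  shows "linear_space A" "1 \<in> carr A"
    "a \<in> carr A \<Longrightarrow> b \<in> carr A \<Longrightarrow> a * b \<in> carr A"
    "a \<in> carr A \<Longrightarrow> b \<in> carr A \<Longrightarrow> scal A c (a * b) = scal A c a * b"
    "a \<in> carr A \<Longrightarrow> b \<in> carr A \<Longrightarrow> scal A c (a * b) = a * scal A c b"
  using assms unfolding unitary_algebra_def linear_space_def by blast+

lemma linear_hom_mult: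
  assumes "unitary_algebra A" "a \<in> carr A"
  shows "linear_hom A A (\<lambda>x. a * x)" "linear_hom A A (\<lambda>x. x * a)"
  using assms unitary_algebraD[OF assms(1)] by (auto simp: linear_hom_def algebra_simps)

lemma linear_hom_linext:
  assumes A: "linear_space A" and B: "linear_space B" and f: "linear_hom A B f"
    and g: "\<And>k. k \<in> Poly_Mapping.keys p \<Longrightarrow> g k \<in> carr A"
  shows "f (linext (scal A) g p) = linext (scal B) (\<lambda>k. f (g k)) p"
proof -
  note lA = linear_spaceD[OF A] and lf = linear_homD[OF f]
  have f0: "f 0 = 0" using lf(2)[OF lA(2) lA(2)] by simp
  \<comment> \<open>Membership of the partial sums is carried along because \<open>f\<close> is
    additive on the carrier only.\<close>
  have "(\<Sum>k\<in>K. scal A (c k) (g k)) \<in> carr A \<and>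
      f (\<Sum>k\<in>K. scal A (c k) (g k)) = (\<Sum>k\<in>K. scal B (c k) (f (g k)))"
    if "finite K" "\<And>k. k \<in> K \<Longrightarrow> g k \<in> carr A" for K and c :: "_ \<Rightarrow> _"
    using that
  proof induction
    case empty
    then show ?case by (simp add: lA(2) f0)
  next
    case (insert k K)
    then show ?case by (simp add: lA(3,4) lf(2,3))
  qed
  from this[of "Poly_Mapping.keys p" "Poly_Mapping.lookup p", OF finite_keys g] show ?thesis by (simp add: linext_def)
qed

section \<open>Convolution of linear maps from a coalgebra to an algebra\<close>

text \<open>Preservation of antipodes compares maps between two different algebras, so the
  convolution is set up on Hom(A, B); for \<open>B\<close> equal to \<open>A\<close> it is
  \<open>conv\<close>.\<close>

definition hconv ::
  "('k::field, 'a::ab_group_add, 'y) bialg_scheme \<Rightarrow> ('k, 'b::ring, 'z) alg_scheme \<Rightarrow>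
   ('a \<Rightarrow> 'b) \<Rightarrow> ('a \<Rightarrow> 'b) \<Rightarrow> 'a \<Rightarrow> 'b" where
  "hconv A B f g a = linext (scal B) (\<lambda>(x, y). f x * g y) (rep (comult A a))"

lemma circ_conv_eq_hconv: "circ_conv A f g a = hconv A A f g a + f a + g a"
  by (simp add: circ_conv_def conv_def hconv_def)

lemma bilinear_modulo_mult:
  assumes "unitary_algebra B" "linear_hom A B f" "linear_hom A B g"
  shows "bilinear_modulo A (scal B) {0} (\<lambda>x y. f x * g y)"
  unfolding bilinear_modulo_def linear_modulo_def
  using linear_homD[OF assms(2)] linear_homD[OF assms(3)] unitary_algebraD(4,5)[OF assms(1)]
  by (auto simp: algebra_simps)

lemma coalgebraD:
  assumes "coassociative_coalgebra A"
  shows "a \<in> carr A \<Longrightarrow> comult A a \<in> tensor2_carr A"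
    "a \<in> carr A \<Longrightarrow> b \<in> carr A \<Longrightarrow> comult A (a + b) = tadd A (comult A a) (comult A b)"
    "a \<in> carr A \<Longrightarrow> comult A (scal A c a) = tscale A c (comult A a)"
    "a \<in> carr A \<Longrightarrow> comult_id A (comult A a) = id_comult A (comult A a)"
  using assms by (auto simp: coassociative_coalgebra_def)

lemma eps_bialgebraD:
  assumes "eps_bialgebra A"
  shows "unitary_algebra A" "coassociative_coalgebra A" "linear_space A"
    "a \<in> carr A \<Longrightarrow> b \<in> carr A \<Longrightarrow>
     comult A (a * b) = tadd A (lact A a (comult A b)) (ract A (comult A a) b)"
  using assms unitary_algebraD(1)[of A] by (auto simp: eps_bialgebra_def)

lemma keys_rep_comult:
  assumes "eps_bialgebra A" "a \<in> carr A"
  shows "Poly_Mapping.keys (rep (comult A a)) \<subseteq> carr A \<times> carr A"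
  using keys_rep_tensor2 coalgebraD(1) eps_bialgebraD(2,3) assms by blast

lemma hconv_cong:
  assumes "eps_bialgebra A" "a \<in> carr A"
    and "\<And>x. x \<in> carr A \<Longrightarrow> f x = f' x" "\<And>x. x \<in> carr A \<Longrightarrow> g x = g' x"
  shows "hconv A B f g a = hconv A B f' g' a"
  unfolding hconv_def using keys_rep_comult[OF assms(1,2)] assms(3,4)
  by (intro linext_cong) auto

text \<open>The product of three linear maps is trilinear, so it descends to the triple tensor
  product. This is the form in which coassociativity can be evaluated in \<open>B\<close>.\<close>

lemma linext_trilin_rels:
  fixes A :: "('k::field, 'a::ab_group_add, 'y) alg_scheme"
  assumes B: "unitary_algebra B"
    and f: "linear_hom A B f" and g: "linear_hom A B g" and h: "linear_hom A B h"
    and t: "t \<in> fs.span (trilin_rels A)"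
  shows "linext (scal B) (\<lambda>(x, y, z). f x * g y * h z) t = 0"
proof -
  interpret vector_space "scal B"
    using unitary_algebraD(1)[OF B] by (simp add: linear_space_def)
  let ?L = "linext (scal B) (\<lambda>(x, y, z). f x * g y * h z)"
  have "fs.subspace {t. ?L t = 0}"
    by (intro fs.subspaceI) (auto simp: linext_add linext_fscale)
  moreover have "trilin_rels A \<subseteq> {t. ?L t = 0}"
    unfolding trilin_rels_def
    using linear_homD[OF f] linear_homD[OF g] linear_homD[OF h] unitary_algebraD(3,4)[OF B]
      unitary_algebraD(5)[OF B, symmetric]
    by (auto simp: linext_diff linext_fscale distrib_left distrib_right)
  ultimately show ?thesis using fs.span_minimal t by blast
qed

lemma linext_mult_left:
  assumes "unitary_algebra B" "b \<in> carr B" "\<And>k. k \<in> Poly_Mapping.keys p \<Longrightarrow> g k \<in> carr B"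
  shows "b * linext (scal B) g p = linext (scal B) (\<lambda>k. b * g k) p"
  using unitary_algebraD(1)[OF assms(1)] assms(3)
  by (intro linear_hom_linext[OF _ _ linear_hom_mult(1)[OF assms(1,2)]])

lemma linext_mult_right:
  assumes "unitary_algebra B" "b \<in> carr B" "\<And>k. k \<in> Poly_Mapping.keys p \<Longrightarrow> g k \<in> carr B"
  shows "linext (scal B) g p * b = linext (scal B) (\<lambda>k. g k * b) p"
  using unitary_algebraD(1)[OF assms(1)] assms(3)
  by (intro linear_hom_linext[OF _ _ linear_hom_mult(2)[OF assms(1,2)]])

lemma cls3_eqD:
  assumes "cls3 A t = cls3 A u"
  shows "t - u \<in> fs.span (trilin_rels A)"
proof -
  have "t \<in> cls3 A t" by (simp add: cls3_def fs.span_zero)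
  then show ?thesis unfolding assms by (simp add: cls3_def)
qed

text \<open>Each bracketing is the trilinear form of \<open>f\<close>, \<open>g\<close>,
  \<open>h\<close> evaluated at a formal sum of triples: \<open>?t\<close> represents
  \<open>id_comult\<close> and \<open>?u\<close> represents \<open>comult_id\<close> of the
  coproduct. By coassociativity they differ by trilinearity relations, which the form kills.\<close>

lemma hconv_assoc:
  assumes A: "eps_bialgebra A" and B: "unitary_algebra B"
    and f: "linear_hom A B f" and g: "linear_hom A B g" and h: "linear_hom A B h"
    and a: "a \<in> carr A"
  shows "hconv A B f (hconv A B g h) a = hconv A B (hconv A B f g) h a"
proof -
  interpret vector_space "scal B"
    using unitary_algebraD(1)[OF B] by (simp add: linear_space_def)
  let ?r = "rep (comult A a)"
  let ?L = "linext (scal B) (\<lambda>(x, y, z). f x * g y * h z)"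
  let ?t = "linext fscale (\<lambda>(a, b). linext fscale (\<lambda>(x, y). basis (a, x, y)) (rep (comult A b))) ?r"
  let ?u = "linext fscale (\<lambda>(a, b). linext fscale (\<lambda>(x, y). basis (x, y, b)) (rep (comult A a))) ?r"
  note hom = linear_homD(1)[OF f] linear_homD(1)[OF g] linear_homD(1)[OF h]
    unitary_algebraD(3)[OF B]
  have k: "x \<in> carr A" "y \<in> carr A" if "(x, y) \<in> Poly_Mapping.keys (rep (comult A b))" "b \<in> carr A" for x y b
    using keys_rep_comult[OF A that(2)] that(1) by auto
  have "hconv A B f (hconv A B g h) a = ?L ?t"
    unfolding linext_linext hconv_def
  proof (intro linext_cong refl; clarify)
    fix x y assume xy: "(x, y) \<in> Poly_Mapping.keys ?r"
    have "f x * linext (scal B) (\<lambda>(x, y). g x * h y) (rep (comult A y))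
        = linext (scal B) (\<lambda>k. f x * (case k of (x, y) \<Rightarrow> g x * h y)) (rep (comult A y))"
      using k[OF xy a] by (intro linext_mult_left[OF B]) (auto intro!: hom dest: k)
    then show "f x * linext (scal B) (\<lambda>(x, y). g x * h y) (rep (comult A y)) =
      ?L (linext fscale (\<lambda>(xa, y). basis (x, xa, y)) (rep (comult A y)))"
      by (simp add: linext_linext split_beta mult.assoc)
  qed
  moreover have "hconv A B (hconv A B f g) h a = ?L ?u"
    unfolding linext_linext hconv_def
  proof (intro linext_cong refl; clarify)
    fix x y assume xy: "(x, y) \<in> Poly_Mapping.keys ?r"
    have "linext (scal B) (\<lambda>(x, y). f x * g y) (rep (comult A x)) * h y
        = linext (scal B) (\<lambda>k. (case k of (x, y) \<Rightarrow> f x * g y) * h y) (rep (comult A x))"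
      using k[OF xy a] by (intro linext_mult_right[OF B]) (auto intro!: hom dest: k)
    then show "linext (scal B) (\<lambda>(x, y). f x * g y) (rep (comult A x)) * h y =
      ?L (linext fscale (\<lambda>(x, ya). basis (x, ya, y)) (rep (comult A x)))"
      by (simp add: linext_linext split_beta)
  qed
  moreover have "?L (?u - ?t) = 0"
    using coalgebraD(4)[OF eps_bialgebraD(2)[OF A] a]
    by (intro linext_trilin_rels[OF B f g h] cls3_eqD) (simp add: comult_id_def id_comult_def)
  ultimately show ?thesis by (simp add: linext_diff)
qed

text \<open>The hypotheses say that \<open>g\<close> is a left and \<open>h\<close> a right inverse of \<open>f\<close> for the circular
  convolution.\<close>

lemma circular_inverse_unique:
  assumes A: "eps_bialgebra A" and B: "unitary_algebra B"
    and f: "linear_hom A B f" and g: "linear_hom A B g" and h: "linear_hom A B h"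
    and gf: "\<And>a. a \<in> carr A \<Longrightarrow> hconv A B g f a + g a + f a = 0"
    and fh: "\<And>a. a \<in> carr A \<Longrightarrow> hconv A B f h a + f a + h a = 0"
    and a: "a \<in> carr A"
  shows "g a = h a"
proof -
  interpret vector_space "scal B"
    using unitary_algebraD(1)[OF B] by (simp add: linear_space_def)
  \<comment> \<open>The triple convolution of \<open>g\<close>, \<open>f\<close>, \<open>h\<close>
    is computed with both bracketings, replacing the convolution of \<open>g\<close> and
    \<open>f\<close> by \<open>- g - f\<close> and that of \<open>f\<close> and \<open>h\<close> by
    \<open>- f - h\<close>. The common term from \<open>g\<close> and \<open>h\<close> cancels, so
    the convolutions of \<open>g\<close> with \<open>f\<close> and of \<open>f\<close> with
    \<open>h\<close> agree, and the hypotheses then give \<open>g = h\<close>.\<close>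
  have "hconv A B (hconv A B g f) h a = hconv A B (\<lambda>x. - g x - f x) h a"
    using gf by (intro hconv_cong[OF A a]) (simp_all add: algebra_simps eq_neg_iff_add_eq_0)
  also have "\<dots> = - hconv A B g h a - hconv A B f h a"
    by (simp add: hconv_def case_prod_unfold left_diff_distrib right_diff_distrib
        linext_fun_uminus linext_fun_diff)
  finally have 1: "hconv A B (hconv A B g f) h a = - hconv A B g h a - hconv A B f h a" .
  have "hconv A B g (hconv A B f h) a = hconv A B g (\<lambda>x. - f x - h x) a"
    using fh by (intro hconv_cong[OF A a]) (simp_all add: algebra_simps eq_neg_iff_add_eq_0)
  also have "\<dots> = - hconv A B g f a - hconv A B g h a"
    by (simp add: hconv_def case_prod_unfold left_diff_distrib right_diff_distrib
        linext_fun_uminus linext_fun_diff)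
  finally have "hconv A B f h a = hconv A B g f a"
    using 1 hconv_assoc[OF A B g f h a] by simp
  then have "g a + (hconv A B g f a + f a) = h a + (hconv A B g f a + f a)"
    using gf[OF a] fh[OF a] by (simp add: algebra_simps)
  then show ?thesis by simp
qed

section \<open>Antipodes and their preservation by bialgebra morphisms\<close>

lemma is_antipode_unique:
  assumes "eps_bialgebra A" "is_antipode A S" "is_antipode A S'" "a \<in> carr A"
  shows "S a = S' a"
proof (rule circular_inverse_unique[OF assms(1) eps_bialgebraD(1)[OF assms(1)] linear_hom_id[of A],
      where g = S and h = S' and a = a])
  show "linear_hom A A S" "linear_hom A A S'"
    using assms(2,3) by (simp_all add: is_antipode_def)
  show "hconv A A S (\<lambda>x. x) a + S a + a = 0" "hconv A A (\<lambda>x. x) S' a + a + S' a = 0"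
    if "a \<in> carr A" for a
    using assms(2,3) that by (simp_all add: is_antipode_def circ_conv_eq_hconv)
qed (rule assms(4))

lemma is_antipode_antipode:
  assumes "eps_hopf_algebra A"
  shows "is_antipode A (antipode A)"
proof -
  have A: "eps_bialgebra A" using assms by (simp add: eps_hopf_algebra_def)
  obtain S where S: "is_antipode A S" using assms by (auto simp: eps_hopf_algebra_def)
  \<comment> \<open>Restricting an antipode makes it extensional and changes no convolution on the
    carrier, since coproducts are represented by pairs from the carrier.\<close>
  have "linear_hom A A (restrict S (carr A))"
    using S by (intro linear_hom_restrict eps_bialgebraD(3)[OF A]) (simp add: is_antipode_def)
  moreover have "hconv A A (\<lambda>x. x) (restrict S (carr A)) a = hconv A A (\<lambda>x. x) S a"
    "hconv A A (restrict S (carr A)) (\<lambda>x. x) a = hconv A A S (\<lambda>x. x) a" if "a \<in> carr A" for a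
    by (rule hconv_cong[OF A that]; simp)+
  ultimately have "is_antipode A (restrict S (carr A))"
    using S by (simp add: is_antipode_def circ_conv_eq_hconv)
  moreover have "T = restrict S (carr A)" if "T \<in> extensional (carr A)" "is_antipode A T" for T
    using that is_antipode_unique[OF A that(2) S] by (intro extensionalityI[of _ "carr A"]) auto
  ultimately have "\<exists>!S. S \<in> extensional (carr A) \<and> is_antipode A S"
    by (intro ex1I[of _ "restrict S (carr A)"]) auto
  from theI'[OF this] show ?thesis by (simp add: antipode_def)
qed

text \<open>Both \<open>\<phi> \<circ> S\<^sub>A\<close> and \<open>S\<^sub>B \<circ> \<phi>\<close> are circular inverses of \<open>\<phi>\<close>.\<close>

lemma eps_hopf_morphismI:
  assumes A: "eps_hopf_algebra A" and B: "eps_hopf_algebra B" and \<phi>: "eps_bialgebra_morphism A B \<phi>"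
  shows "eps_hopf_morphism A B \<phi>"
  unfolding eps_hopf_morphism_def
proof (intro conjI ballI \<phi>)
  fix a assume a: "a \<in> carr A"
  have bA: "eps_bialgebra A" and bB: "eps_bialgebra B"
    using A B by (simp_all add: eps_hopf_algebra_def)
  note uB = eps_bialgebraD(1)[OF bB]
  interpret vector_space "scal B"
    using unitary_algebraD(1)[OF uB] by (simp add: linear_space_def)
  have lin: "linear_hom A B \<phi>" using \<phi> by (simp add: eps_bialgebra_morphism_def)
  have SA: "linear_hom A A (antipode A)"
    "\<And>a. a \<in> carr A \<Longrightarrow> hconv A A (antipode A) (\<lambda>x. x) a + antipode A a + a = 0"
    using is_antipode_antipode[OF A] by (simp_all add: is_antipode_def circ_conv_eq_hconv)
  have SB: "linear_hom B B (antipode B)"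
    "\<And>b. b \<in> carr B \<Longrightarrow> hconv B B (\<lambda>x. x) (antipode B) b + b + antipode B b = 0"
    using is_antipode_antipode[OF B] by (simp_all add: is_antipode_def circ_conv_eq_hconv)
  have l1: "linear_hom A B (\<lambda>x. \<phi> (antipode A x))" by (rule linear_hom_compose[OF SA(1) lin])
  have l2: "linear_hom A B (\<lambda>x. antipode B (\<phi> x))" by (rule linear_hom_compose[OF lin SB(1)])
  \<comment> \<open>Left inverse: the defining equation of the antipode of \<open>A\<close> is
    pushed forward along the multiplicative map \<phi>.\<close>
  have "hconv A B (\<lambda>x. \<phi> (antipode A x)) \<phi> a + \<phi> (antipode A a) + \<phi> a = 0" if a: "a \<in> carr A" for a
  proof -
    have k: "x \<in> carr A \<and> y \<in> carr A" if "(x, y) \<in> Poly_Mapping.keys (rep (comult A a))" for x y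
      using that keys_rep_comult[OF bA a] by auto
    have mult: "\<phi> (x * y) = \<phi> x * \<phi> y" if "x \<in> carr A" "y \<in> carr A" for x y
      using \<phi> that by (simp add: eps_bialgebra_morphism_def)
    have cl: "antipode A x \<in> carr A" if "x \<in> carr A" for x
      using linear_homD(1)[OF SA(1)] that .
    have "hconv A A (antipode A) (\<lambda>x. x) a \<in> carr A"
      unfolding hconv_def using k
      by (intro vector_space.linext_in_subspace)
        (use eps_bialgebraD(3)[OF bA] unitary_algebraD(3)[OF eps_bialgebraD(1)[OF bA]] in
          \<open>auto simp: linear_space_def cl\<close>)
    moreover have "\<phi> (hconv A A (antipode A) (\<lambda>x. x) a) = hconv A B (\<lambda>x. \<phi> (antipode A x)) \<phi> a"
      unfolding hconv_def
      by (subst linear_hom_linext[OF eps_bialgebraD(3)[OF bA] eps_bialgebraD(3)[OF bB] lin])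
        (auto dest!: k intro!: linext_cong mult cl unitary_algebraD(3)[OF eps_bialgebraD(1)[OF bA]])
    moreover have "\<phi> 0 = 0"
      using linear_homD(2)[OF lin linear_spaceD(2,2)[OF eps_bialgebraD(3)[OF bA]]] by simp
    ultimately show ?thesis
      using SA(2)[OF a] linear_homD(2)[OF lin] cl[OF a] a
        linear_spaceD(3)[OF eps_bialgebraD(3)[OF bA]] by metis
  qed
  \<comment> \<open>Right inverse: the equation for the antipode of \<open>B\<close> is evaluated at
    \<open>\<phi> a\<close>, whose coproduct comes from that of \<open>a\<close> because \<phi> is a
    coalgebra map.\<close>
  moreover have "hconv A B \<phi> (\<lambda>x. antipode B (\<phi> x)) a + \<phi> a + antipode B (\<phi> a) = 0"
    if a: "a \<in> carr A" for a
  proof -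
    have "hconv B B (\<lambda>x. x) (antipode B) (\<phi> a)
        = linext (scal B) (\<lambda>(x, y). x * antipode B y) (rep (tmap B \<phi> \<phi> (comult A a)))"
      using \<phi> a by (simp add: hconv_def eps_bialgebra_morphism_def)
    also have "\<dots> = hconv A B \<phi> (\<lambda>x. antipode B (\<phi> x)) a"
      unfolding tmap_def linext_rep_cls2[OF vector_space_axioms
          bilinear_modulo_mult[OF uB linear_hom_id SB(1)]] linext_linext hconv_def
      by (simp add: case_prod_unfold)
    finally show ?thesis using SB(2)[OF linear_homD(1)[OF lin a]] by simp
  qed
  ultimately show "antipode B (\<phi> a) = \<phi> (antipode A a)"
    by (intro circular_inverse_unique[OF bA uB lin l1 l2 _ _ a, symmetric]) 
qed

section \<open>Calculus of linear maps modulo a subspace\<close>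

lemma linear_modulo_exact:
  assumes "vector_space s" "module.subspace s W"
    "\<And>a b. a \<in> carr A \<Longrightarrow> b \<in> carr A \<Longrightarrow> g (a + b) = g a + g b"
    "\<And>c a. a \<in> carr A \<Longrightarrow> g (scal A c a) = s c (g a)"
  shows "linear_modulo A s W g"
proof -
  interpret vector_space s by fact
  show ?thesis using assms subspace_0 by (simp add: linear_modulo_def)
qed

lemma linear_modulo_add:
  assumes "vector_space s" "module.subspace s W" "linear_modulo A s W g" "linear_modulo A s W h"
  shows "linear_modulo A s W (\<lambda>a. g a + h a)"
proof -
  interpret vector_space s by fact
  have "g (a + b) + h (a + b) - (g a + h a) - (g b + h b)
      = (g (a + b) - g a - g b) + (h (a + b) - h a - h b)" for a b
    by simp
  moreover have "g (scal A c a) + h (scal A c a) - s c (g a + h a)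
      = (g (scal A c a) - s c (g a)) + (h (scal A c a) - s c (h a))" for c a
    by (simp add: scale_right_distrib)
  ultimately show ?thesis
    using assms(3,4) subspace_add[OF assms(2)] unfolding linear_modulo_def by metis
qed

lemma linear_modulo_diff:
  assumes "vector_space s" "module.subspace s W" "linear_modulo A s W g" "linear_modulo A s W h"
  shows "linear_modulo A s W (\<lambda>a. g a - h a)"
proof -
  interpret vector_space s by fact
  have "g (a + b) - h (a + b) - (g a - h a) - (g b - h b)
      = (g (a + b) - g a - g b) - (h (a + b) - h a - h b)" for a b
    by simp
  moreover have "g (scal A c a) - h (scal A c a) - s c (g a - h a)
      = (g (scal A c a) - s c (g a)) - (h (scal A c a) - s c (h a))" for c a
    by (simp add: scale_right_diff_distrib)
  ultimately show ?thesis
    using assms(3,4) subspace_diff[OF assms(2)] unfolding linear_modulo_def by metis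
qed

lemma linear_modulo_linext:
  assumes "vector_space s" "module.subspace s W"
    and "\<And>k. k \<in> Poly_Mapping.keys t \<Longrightarrow> linear_modulo A s W (\<lambda>a. g a k)"
  shows "linear_modulo A s W (\<lambda>a. linext s (g a) t)"
proof -
  interpret vector_space s by fact
  show ?thesis
    unfolding linear_modulo_def linext_fun_diff[symmetric] linext_fun_scale[symmetric]
    using assms(3) by (intro conjI ballI allI linext_in_subspace[OF assms(2)])
      (simp_all add: linear_modulo_def)
qed

section \<open>Maps to the triple tensor product\<close>

lemma trilin_span_basis:
  fixes A :: "('k::field, 'a::ab_group_add, 'z) alg_scheme"
  assumes "a \<in> carr A" "b \<in> carr A"
  shows "linear_modulo A fscale (fs.span (trilin_rels A)) (\<lambda>x. basis (x, a, b))"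
    "linear_modulo A fscale (fs.span (trilin_rels A)) (\<lambda>x. basis (a, x, b))"
    "linear_modulo A fscale (fs.span (trilin_rels A)) (\<lambda>x. basis (a, b, x))"
  unfolding linear_modulo_def
  \<comment> \<open>The wanted relation lies in one of the six families; they are tried one by one,
    the last of the union first.\<close>
  by (intro conjI ballI allI; rule fs.span_base; unfold trilin_rels_def;
      (((rule UnI2)?, intro CollectI exI conjI, rule refl, (rule assms | assumption)+) | rule UnI1)+)+

lemma cls3_eqI:
  assumes "t - u \<in> fs.span (trilin_rels A)"
  shows "cls3 A t = cls3 A u"
proof -
  have "w - t \<in> fs.span (trilin_rels A) \<longleftrightarrow> w - u \<in> fs.span (trilin_rels A)" for w
    using fs.span_add[OF _ assms, of "w - t"] fs.span_diff[OF _ assms, of "w - u"]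
    by (auto simp: algebra_simps)
  then show ?thesis by (auto simp: cls3_def)
qed

text \<open>Both iterated coproducts contain two layers of chosen representatives. A linear choice
  \<open>D\<close> of formal representatives of the coproduct removes both layers.\<close>

lemma comult_on_cls2:
  fixes A :: "('k::field, 'a::ab_group_add, 'z) bialg_scheme"
  assumes A: "linear_space A" and t: "Poly_Mapping.keys t \<subseteq> carr A \<times> carr A"
    and D: "\<And>a. a \<in> carr A \<Longrightarrow> comult A a = cls2 A (D a)"
    and Dk: "\<And>a. a \<in> carr A \<Longrightarrow> Poly_Mapping.keys (D a) \<subseteq> carr A \<times> carr A"
    and Dadd: "\<And>a b. a \<in> carr A \<Longrightarrow> b \<in> carr A \<Longrightarrow> D (a + b) = D a + D b"
    and Dscal: "\<And>c a. a \<in> carr A \<Longrightarrow> D (scal A c a) = fscale c (D a)"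
  shows "id_comult A (cls2 A t) =
      cls3 A (linext fscale (\<lambda>(a, b). linext fscale (\<lambda>(x, y). basis (a, x, y)) (D b)) t)"
    "comult_id A (cls2 A t) =
      cls3 A (linext fscale (\<lambda>(a, b). linext fscale (\<lambda>(x, y). basis (x, y, b)) (D a)) t)"
proof -
  let ?W = "fs.span (trilin_rels A)"
  have W: "fs.subspace ?W" by simp
  note vs = vector_space_fscale
  note k = keys_rep_cls2[OF A t]
  \<comment> \<open>Passing from \<beta> to \<gamma> replaces the inner representatives by
    \<open>D\<close>. Bilinearity of \<gamma> modulo the trilinear relations then replaces the outer
    representative by \<open>t\<close>.\<close>
  have general: "cls3 A (linext fscale (\<lambda>(a, b). \<beta> a b) (rep (cls2 A t))) =
      cls3 A (linext fscale (\<lambda>(a, b). \<gamma> a b) t)"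
    if \<gamma>: "bilinear_modulo A fscale ?W \<gamma>"
      and \<beta>: "\<And>a b. a \<in> carr A \<Longrightarrow> b \<in> carr A \<Longrightarrow> \<beta> a b - \<gamma> a b \<in> ?W" for \<beta> \<gamma>
  proof -
    let ?r = "rep (cls2 A t)"
    have "linext fscale (\<lambda>(a, b). \<beta> a b) ?r - linext fscale (\<lambda>(a, b). \<gamma> a b) ?r \<in> ?W"
      unfolding fs.linext_fun_diff[symmetric]
      using k \<beta> by (intro fs.linext_in_subspace[OF W]) auto
    moreover have "linext fscale (\<lambda>(a, b). \<gamma> a b) ?r - linext fscale (\<lambda>(a, b). \<gamma> a b) t \<in> ?W"
      by (rule linext_bilinear_cong[OF vs W \<gamma> rep_cls2_congruent])
    ultimately show ?thesis
      by (intro cls3_eqI) (use fs.span_add in fastforce)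
  qed
  have repD: "rep (comult A a) - D a \<in> fs.span (bilin_rels A)" if "a \<in> carr A" for a
    using rep_cls2_congruent D[OF that] by simp
  show "id_comult A (cls2 A t) =
      cls3 A (linext fscale (\<lambda>(a, b). linext fscale (\<lambda>(x, y). basis (a, x, y)) (D b)) t)"
    unfolding id_comult_def
  proof (rule general)
    show "bilinear_modulo A fscale ?W (\<lambda>a b. linext fscale (\<lambda>(x, y). basis (a, x, y)) (D b))"
      unfolding bilinear_modulo_def
    proof (intro conjI ballI)
      fix b assume "b \<in> carr A"
      then show "linear_modulo A fscale ?W (\<lambda>a. linext fscale (\<lambda>(x, y). basis (a, x, y)) (D b))"
        using Dk by (intro linear_modulo_linext[OF vs W]) (auto intro!: trilin_span_basis)
    next
      fix a assume "a \<in> carr A"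
      show "linear_modulo A fscale ?W (\<lambda>b. linext fscale (\<lambda>(x, y). basis (a, x, y)) (D b))"
        by (intro linear_modulo_exact[OF vs W])
          (simp_all add: Dadd Dscal fs.linext_add fs.linext_fscale)
    qed
    show "linext fscale (\<lambda>(x, y). basis (a, x, y)) (rep (comult A b)) -
        linext fscale (\<lambda>(x, y). basis (a, x, y)) (D b) \<in> ?W" if "a \<in> carr A" "b \<in> carr A" for a b
      using that
      by (intro linext_bilinear_cong[OF vs W _ repD])
        (auto simp: bilinear_modulo_def intro: trilin_span_basis)
  qed
  show "comult_id A (cls2 A t) =
      cls3 A (linext fscale (\<lambda>(a, b). linext fscale (\<lambda>(x, y). basis (x, y, b)) (D a)) t)"
    unfolding comult_id_def
  proof (rule general)
    show "bilinear_modulo A fscale ?W (\<lambda>a b. linext fscale (\<lambda>(x, y). basis (x, y, b)) (D a))"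
      unfolding bilinear_modulo_def
    proof (intro conjI ballI)
      fix a assume "a \<in> carr A"
      then show "linear_modulo A fscale ?W (\<lambda>b. linext fscale (\<lambda>(x, y). basis (x, y, b)) (D a))"
        using Dk by (intro linear_modulo_linext[OF vs W]) (auto intro!: trilin_span_basis)
    next
      fix b assume "b \<in> carr A"
      show "linear_modulo A fscale ?W (\<lambda>a. linext fscale (\<lambda>(x, y). basis (x, y, b)) (D a))"
        by (intro linear_modulo_exact[OF vs W])
          (simp_all add: Dadd Dscal fs.linext_add fs.linext_fscale)
    qed
    show "linext fscale (\<lambda>(x, y). basis (x, y, b)) (rep (comult A a)) -
        linext fscale (\<lambda>(x, y). basis (x, y, b)) (D a) \<in> ?W" if "a \<in> carr A" "b \<in> carr A" for a b
      using that
      by (intro linext_bilinear_cong[OF vs W _ repD])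
        (auto simp: bilinear_modulo_def intro: trilin_span_basis)
  qed
qed

section \<open>The coproduct of a forest as a list of pairs of forests\<close>

text \<open>On decorated forests there is one entry per vertex v: the forests induced on the
  vertices before and after v in postorder. Descendants of v and everything to its left go left;
  ancestors and everything to its right go right. A vertex decorated by \<open>Some x\<close> is
  treated as a leaf.\<close>

fun cuts :: "'x forest \<Rightarrow> ('x forest \<times> 'x forest) list" where
  "cuts [] = []"
| "cuts (Node (Some x) us # ts) =
     ([], ts) # map (\<lambda>(a, b). (Node (Some x) us # a, b)) (cuts ts)"
| "cuts (Node None F # ts) =
     (F, ts) # map (\<lambda>(a, b). (a, Node None b # ts)) (cuts F)
       @ map (\<lambda>(a, b). (Node None F # a, b)) (cuts ts)"

text \<open>This is the derivation rule on forests: the deleted vertex lies in \<open>F\<close>, and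
  \<open>G\<close> joins the right part, or in \<open>G\<close>, and \<open>F\<close> joins the left
  part.\<close>

lemma cuts_append:
  "cuts (F @ G) = map (\<lambda>(a, b). (a, b @ G)) (cuts F) @ map (\<lambda>(a, b). (F @ a, b)) (cuts G)"
  by (induction F rule: cuts.induct) (auto simp: case_prod_unfold comp_def)

text \<open>At least one vertex is lost, and \<open>size_list size\<close> counts every vertex
  twice. This makes the recursive antipodes terminate.\<close>

lemma size_cuts:
  "(a, b) \<in> set (cuts F) \<Longrightarrow> size_list size a < size_list size F \<and> size_list size b < size_list size F"
  by (induction F arbitrary: a b rule: cuts.induct) fastforce+

lemma forests_simps [simp]:
  "[] \<in> forests X"
  "t # F \<in> forests X \<longleftrightarrow> leaf_decorated X t \<and> F \<in> forests X"
  "F @ G \<in> forests X \<longleftrightarrow> F \<in> forests X \<and> G \<in> forests X"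
  "leaf_decorated X (Node None F) \<longleftrightarrow> F \<in> forests X"
  by (auto simp: forests_def)

declare leaf_decorated.simps [simp del]

lemma leaf_decorated_Some [simp]:
  "leaf_decorated X (Node (Some x) us) \<longleftrightarrow> x \<in> X \<and> us = []"
  by (auto simp: leaf_decorated.simps)

lemma cuts_forests:
  "(a, b) \<in> set (cuts F) \<Longrightarrow> F \<in> forests X \<Longrightarrow> a \<in> forests X \<and> b \<in> forests X"
  by (induction F arbitrary: a b rule: cuts.induct) fastforce+

lemma sum_list_swap:
  "(\<Sum>x\<leftarrow>xs. \<Sum>y\<leftarrow>ys. f x y) = (\<Sum>y\<leftarrow>ys. \<Sum>x\<leftarrow>xs. f x y :: 'a::comm_monoid_add)"
  by (induction xs) (simp_all add: sum_list_addf)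

text \<open>For decorated forests, both sides run over pairs of vertices v before w in postorder and
  apply \<open>g\<close> to the parts before v, between v and w, and after w. The left side deletes
  w first, the right side v.\<close>

lemma cuts_coassoc:
  fixes g :: "'x forest \<Rightarrow> 'x forest \<Rightarrow> 'x forest \<Rightarrow> 'v::ab_group_add"
  shows "(\<Sum>p\<leftarrow>cuts F. \<Sum>q\<leftarrow>cuts (fst p). g (fst q) (snd q) (snd p)) =
    (\<Sum>p\<leftarrow>cuts F. \<Sum>q\<leftarrow>cuts (snd p). g (fst p) (fst q) (snd q))"
proof (induction F arbitrary: g rule: cuts.induct)
  case 1
  then show ?case by simp
next
  case (2 x us ts)
  let ?t = "Node (Some x) us"
  from 2[of "\<lambda>a. g (?t # a)"] show ?case
    by (simp add: case_prod_unfold comp_def sum_list_addf)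
next
  case (3 F ts)
  let ?t = "Node None F"
  \<comment> \<open>These are the terms with v below the root of the first tree and w in
    \<open>ts\<close>: the two sides produce them with the nesting of the sums exchanged.\<close>
  have "(\<Sum>p\<leftarrow>cuts ts. \<Sum>q\<leftarrow>cuts F. g (fst q) (Node None (snd q) # fst p) (snd p)) =
      (\<Sum>q\<leftarrow>cuts F. \<Sum>p\<leftarrow>cuts ts. g (fst q) (Node None (snd q) # fst p) (snd p))"
    by (rule sum_list_swap)
  with "3.IH"(1)[of "\<lambda>a b c. g a b (Node None c # ts)"] "3.IH"(2)[of "\<lambda>a. g (?t # a)"]
  show ?case
    by (simp add: case_prod_unfold comp_def sum_list_addf algebra_simps)
qed

section \<open>The Hopf algebra of decorated forests\<close>

lemma H_forests_simps [simp]: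
  "carr (H_forests X :: ('k::field, 'x forest \<Rightarrow>\<^sub>0 'k) opalg) = {p. Poly_Mapping.keys p \<subseteq> forests X}"
  "scal (H_forests X :: ('k, 'x forest \<Rightarrow>\<^sub>0 'k) opalg) = fscale"
  "comult (H_forests X :: ('k, 'x forest \<Rightarrow>\<^sub>0 'k) opalg) = Delta_eps X"
  "oper (H_forests X :: ('k, 'x forest \<Rightarrow>\<^sub>0 'k) opalg) = Bplus"
  by (simp_all add: H_forests_def H_alg_def)

text \<open>\<open>Delta_forest\<close> is phrased over \<open>H_alg\<close>, since the coproduct
  field of \<open>H_forests\<close> depends on it. The two records share carrier and scalars, hence
  the same tensors.\<close>

lemma cls2_H_alg:
  "cls2 (H_alg X :: ('k::field, 'x forest \<Rightarrow>\<^sub>0 'k) alg) = cls2 (H_forests X :: ('k, 'x forest \<Rightarrow>\<^sub>0 'k) opalg)"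
proof -
  have "bilin_rels (H_alg X :: ('k, 'x forest \<Rightarrow>\<^sub>0 'k) alg) =
      bilin_rels (H_forests X :: ('k, 'x forest \<Rightarrow>\<^sub>0 'k) opalg)"
    unfolding bilin_rels_def H_forests_simps by (simp add: H_alg_def)
  then show ?thesis by (simp add: cls2_def fun_eq_iff)
qed

lemma tensor_ops_H_alg:
  "pure (H_alg X :: ('k::field, 'x forest \<Rightarrow>\<^sub>0 'k) alg) = pure (H_forests X :: ('k, 'x forest \<Rightarrow>\<^sub>0 'k) opalg)"
  "tadd (H_alg X :: ('k, 'x forest \<Rightarrow>\<^sub>0 'k) alg) = tadd (H_forests X :: ('k, 'x forest \<Rightarrow>\<^sub>0 'k) opalg)"
  "tmap (H_alg X :: ('k, 'x forest \<Rightarrow>\<^sub>0 'k) alg) f g = tmap (H_forests X :: ('k, 'x forest \<Rightarrow>\<^sub>0 'k) opalg) f g"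
  "lact (H_alg X :: ('k, 'x forest \<Rightarrow>\<^sub>0 'k) alg) = lact (H_forests X :: ('k, 'x forest \<Rightarrow>\<^sub>0 'k) opalg)"
  "ract (H_alg X :: ('k, 'x forest \<Rightarrow>\<^sub>0 'k) alg) = ract (H_forests X :: ('k, 'x forest \<Rightarrow>\<^sub>0 'k) opalg)"
  by (simp_all add: fun_eq_iff pure_def tadd_def tmap_def lact_def ract_def cls2_H_alg)

text \<open>This brings the convolution product of \<open>Poly_Mapping\<close> into the calculus of
  linear extensions.\<close>

lemma times_eq_linext:
  fixes p q :: "'a list \<Rightarrow>\<^sub>0 'k::field"
  shows "p * q = linext fscale (\<lambda>F. linext fscale (\<lambda>G. basis (F @ G)) q) p"
proof -
  have "fscale c (basis F) * fscale d (basis G) = fscale c (fscale d (basis (F @ G) :: 'a list \<Rightarrow>\<^sub>0 'k))"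
    for c d F G
  proof -
    have "fscale c (Poly_Mapping.single F d) = (Poly_Mapping.single F (c * d) :: 'a list \<Rightarrow>\<^sub>0 'k)" for c d F
      by (rule poly_mapping_eqI) (simp add: lookup_single when_def)
    then show ?thesis by (simp add: mult_single plus_list_def)
  qed
  moreover have "p * q = linext fscale basis p * linext fscale basis q" by simp
  ultimately show ?thesis
    unfolding linext_def by (simp add: sum_product fs.scale_sum_right)
qed

lemma linear_space_H_forests: "linear_space (H_forests X :: ('k::field, 'x forest \<Rightarrow>\<^sub>0 'k) opalg)"
  by (simp add: linear_space_def vector_space_fscale subspace_keys_subset)

lemma unitary_algebra_H_forests: "unitary_algebra (H_forests X :: ('k::field, 'x forest \<Rightarrow>\<^sub>0 'k) opalg)"
proof -
  have "Poly_Mapping.keys (p * q) \<subseteq> forests X"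
    if "Poly_Mapping.keys p \<subseteq> forests X" "Poly_Mapping.keys q \<subseteq> forests X" for p q :: "'x forest \<Rightarrow>\<^sub>0 'k"
    unfolding times_eq_linext using that by (intro keys_linext_subset) auto
  then show ?thesis
    unfolding unitary_algebra_def
    by (auto simp: vector_space_fscale subspace_keys_subset one_eq_basis times_eq_linext
        fs.linext_fscale fs.linext_fun_scale)
qed

section \<open>The coproduct lifted to formal sums of pairs\<close>

definition cop_forest :: "'x forest \<Rightarrow> (('x forest \<Rightarrow>\<^sub>0 'k::field) \<times> ('x forest \<Rightarrow>\<^sub>0 'k) \<Rightarrow>\<^sub>0 'k)" where
  "cop_forest F = (\<Sum>(a, b)\<leftarrow>cuts F. basis (basis a, basis b))"

text \<open>A linear choice of representatives for \<open>Delta_eps\<close>, as required of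
  \<open>D\<close> in \<open>comult_on_cls2\<close>.\<close>

definition cop :: "('x forest \<Rightarrow>\<^sub>0 'k::field) \<Rightarrow> (('x forest \<Rightarrow>\<^sub>0 'k) \<times> ('x forest \<Rightarrow>\<^sub>0 'k) \<Rightarrow>\<^sub>0 'k)" where
  "cop = linext fscale cop_forest"

lemma cop_basis [simp]: "cop (basis F) = cop_forest F"
  by (simp add: cop_def)

lemma cop_add: "cop (p + q) = cop p + cop q"
  by (simp add: cop_def fs.linext_add)

lemma cop_fscale: "cop (fscale c p) = fscale c (cop p)"
  by (simp add: cop_def fs.linext_fscale)

lemma (in vector_space) linext_cop_forest:
  "linext scale (\<lambda>(a, b). g a b) (cop_forest F) = (\<Sum>(a, b)\<leftarrow>cuts F. g (basis a) (basis b))"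
  by (simp add: cop_forest_def linext_sum_list case_prod_unfold)

lemma Bplus_basis [simp]: "Bplus (basis F) = basis [Node None F]"
  by (simp add: Bplus_def)

lemma keys_sum_list_subset:
  "(\<And>x. x \<in> set xs \<Longrightarrow> Poly_Mapping.keys (f x) \<subseteq> K) \<Longrightarrow> Poly_Mapping.keys (\<Sum>x\<leftarrow>xs. f x) \<subseteq> K"
proof (induction xs)
  case (Cons x xs)
  then show ?case using keys_add[of "f x" "\<Sum>x\<leftarrow>xs. f x"] by force
qed simp

lemma keys_cop_forest:
  "F \<in> forests X \<Longrightarrow> Poly_Mapping.keys (cop_forest F :: ('x forest \<Rightarrow>\<^sub>0 'k::field) \<times> _ \<Rightarrow>\<^sub>0 'k)
    \<subseteq> carr (H_forests X :: ('k, 'x forest \<Rightarrow>\<^sub>0 'k) opalg) \<times> carr (H_forests X :: ('k, 'x forest \<Rightarrow>\<^sub>0 'k) opalg)"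
  unfolding cop_forest_def by (rule keys_sum_list_subset) (auto dest: cuts_forests)

lemma keys_cop:
  "p \<in> carr (H_forests X :: ('k::field, 'x forest \<Rightarrow>\<^sub>0 'k) opalg) \<Longrightarrow> Poly_Mapping.keys (cop p)
    \<subseteq> carr (H_forests X :: ('k, 'x forest \<Rightarrow>\<^sub>0 'k) opalg) \<times> carr (H_forests X :: ('k, 'x forest \<Rightarrow>\<^sub>0 'k) opalg)"
  unfolding cop_def by (intro keys_linext_subset keys_cop_forest) auto

lemma linear_hom_linext_fscale:
  assumes "linear_space B" "\<And>F. F \<in> forests X \<Longrightarrow> g F \<in> carr B"
  shows "linear_hom (H_forests X :: ('k::field, 'x forest \<Rightarrow>\<^sub>0 'k) opalg) B (linext (scal B) g)"
proof -
  interpret vector_space "scal B" using assms(1) by (simp add: linear_space_def)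
  show ?thesis
    using assms unfolding linear_hom_def
    by (auto simp: linext_add linext_fscale linear_space_def intro!: linext_in_subspace)
qed

lemma linear_hom_Bplus:
  "linear_hom (H_forests X :: ('k::field, 'x forest \<Rightarrow>\<^sub>0 'k) opalg) (H_forests X :: ('k, 'x forest \<Rightarrow>\<^sub>0 'k) opalg) Bplus"
  using linear_hom_linext_fscale[OF linear_space_H_forests, of X "\<lambda>F. basis [Node None F]" X]
  by (simp add: Bplus_def)

lemma cls2_zero: "cls2 A 0 = cls2 A t \<longleftrightarrow> t \<in> fs.span (bilin_rels A)"
  using fs.span_neg[of t "bilin_rels A"] fs.span_neg[of "- t" "bilin_rels A"]
  by (auto simp: cls2_eq_iff)

lemma lact_cls2:
  assumes "unitary_algebra A" "a \<in> carr A"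
  shows "lact A a (cls2 A t) = cls2 A (linext fscale (\<lambda>(x, y). basis (a * x, y)) t)"
  unfolding lact_def by (rule tmap_cls2[OF linear_hom_mult(1)[OF assms] linear_hom_id])

lemma ract_cls2:
  assumes "unitary_algebra A" "a \<in> carr A"
  shows "ract A (cls2 A t) a = cls2 A (linext fscale (\<lambda>(x, y). basis (x, y * a)) t)"
  unfolding ract_def by (rule tmap_cls2[OF linear_hom_id linear_hom_mult(2)[OF assms]])

lemma Delta_forest_eq:
  fixes X :: "'x set"
  assumes "F \<in> forests X"
  shows "Delta_forest X F = cls2 (H_forests X :: ('k::field, 'x forest \<Rightarrow>\<^sub>0 'k) opalg) (cop_forest F)"
  using assms
proof (induction X F rule: Delta_forest.induct)
  case (1 X)
  then show ?case by (simp add: cop_forest_def cls2_H_alg)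
next
  case (2 X x ts)
  then show ?case by (simp add: cop_forest_def tensor_ops_H_alg pure_def one_eq_basis)
next
  case (3 X F)
  have "tmap (H_forests X :: ('k, 'x forest \<Rightarrow>\<^sub>0 'k) opalg) (\<lambda>p. p) Bplus (cls2 (H_forests X) (cop_forest F)) =
      cls2 (H_forests X) (\<Sum>(a, b)\<leftarrow>cuts F. basis (basis a, basis [Node None b]))"
    unfolding tmap_cls2[OF linear_hom_id linear_hom_Bplus] fs.linext_cop_forest by simp
  with 3 show ?case
    by (simp add: tensor_ops_H_alg pure_def tadd_cls2 one_eq_basis cop_forest_def
        case_prod_unfold comp_def)
next
  case (4 X t u ts)
  let ?H = "H_forests X :: ('k, 'x forest \<Rightarrow>\<^sub>0 'k) opalg"
  have "basis [t] \<in> carr ?H" "basis (u # ts) \<in> carr ?H" using "4.prems" by auto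
  note act = lact_cls2[OF unitary_algebra_H_forests this(1)]
    ract_cls2[OF unitary_algebra_H_forests this(2)]
  \<comment> \<open>\<open>cuts\<close> inspects the shape of the first tree, while
    \<open>Delta_forest\<close> splits off that tree as a factor; \<open>cuts_append\<close>
    reconciles the two recursions.\<close>
  have "cop_forest (t # u # ts) =
      (\<Sum>(a, b)\<leftarrow>cuts (u # ts). basis (basis ([t] @ a), basis b)) +
      (\<Sum>(a, b)\<leftarrow>cuts [t]. basis (basis a, basis (b @ u # ts) :: 'x forest \<Rightarrow>\<^sub>0 'k))"
    using cuts_append[of "[t]" "u # ts"]
    by (simp add: cop_forest_def case_prod_unfold comp_def add.commute)
  then show ?case
    using 4 by (simp add: tensor_ops_H_alg act fs.linext_cop_forest tadd_cls2 basis_times_basis)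
qed

text \<open>Forest by forest the chosen representative differs from \<open>cop_forest\<close> by
  relations, and linear combinations preserve this.\<close>

lemma Delta_eps_eq:
  fixes X :: "'x set"
  assumes "p \<in> carr (H_forests X :: ('k::field, 'x forest \<Rightarrow>\<^sub>0 'k) opalg)"
  shows "Delta_eps X p = cls2 (H_forests X :: ('k, 'x forest \<Rightarrow>\<^sub>0 'k) opalg) (cop p)"
  unfolding Delta_eps_def cls2_H_alg cop_def cls2_eq_iff fs.linext_fun_diff[symmetric]
  using assms by (intro fs.linext_in_subspace fs.subspace_span)
    (auto simp: Delta_forest_eq intro!: rep_cls2_congruent)

text \<open>Membership in \<open>W\<close> passes through sums and scalar multiples because the
  defects of linearity lie in \<open>W\<close> as well. It transfers identities from forests to all
  vectors when they hold only modulo relations.\<close>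

lemma linear_modulo_H_forests_induct:
  fixes X :: "'x set" and A :: "('k::field, 'x forest \<Rightarrow>\<^sub>0 'k) opalg"
  defines "A \<equiv> H_forests X"
  assumes "vector_space s" and W: "module.subspace s W" and G: "linear_modulo A s W G"
    and B: "\<And>F. F \<in> forests X \<Longrightarrow> G (basis F) \<in> W"
    and p: "p \<in> carr A"
  shows "G p \<in> W"
proof -
  interpret vector_space s by fact
  have "linear_space A" unfolding A_def by (rule linear_space_H_forests)
  note lA = linear_spaceD[OF this]
  have sA: "scal A = fscale" by (simp add: A_def)
  have add: "G (a + b) \<in> W" if "a \<in> carr A" "b \<in> carr A" "G a \<in> W" "G b \<in> W" for a b
  proof -
    have "G (a + b) - G a - G b \<in> W" using G that by (simp add: linear_modulo_def)
    from subspace_add[OF W subspace_add[OF W this that(4)] that(3)] show ?thesis by simp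
  qed
  have scal: "G (fscale c a) \<in> W" if "a \<in> carr A" "G a \<in> W" for c a
  proof -
    have "G (fscale c a) - s c (G a) \<in> W" using G that by (simp add: linear_modulo_def A_def)
    from subspace_add[OF W this subspace_scale[OF W that(2), of c]] show ?thesis by simp
  qed
  have "(\<Sum>F\<in>K. fscale (c F) (basis F)) \<in> carr A \<and> G (\<Sum>F\<in>K. fscale (c F) (basis F)) \<in> W"
    if "finite K" "K \<subseteq> forests X" for K c
    using that
  proof induction
    case empty
    \<comment> \<open>The additivity defect at zero equals \<open>- G 0\<close>.\<close>
    have "G (0 + 0) - G 0 - G 0 \<in> W"
      using G lA(2) unfolding linear_modulo_def by blast
    from subspace_neg[OF W this] show ?case using lA(2) by simp
  next
    case (insert F K)
    have "basis F \<in> carr A" using insert.prems by (simp add: A_def)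
    with insert show ?case
      using lA(4)[of "basis F" "c F"] by (auto intro!: add scal B lA(3) simp: sA)
  qed
  from this[OF finite_keys] p have "G (linext fscale basis p) \<in> W"
    unfolding linext_def by (auto simp: A_def)
  then show ?thesis by simp
qed

text \<open>The defect \<open>?E\<close> is linear in each factor modulo the relations and vanishes
  exactly on two forests. It is extended first in the second factor, then in the first.\<close>

lemma cop_mult:
  fixes p q :: "'x forest \<Rightarrow>\<^sub>0 'k::field"
  assumes p: "p \<in> carr (H_forests X :: ('k, 'x forest \<Rightarrow>\<^sub>0 'k) opalg)"
    and q: "q \<in> carr (H_forests X :: ('k, 'x forest \<Rightarrow>\<^sub>0 'k) opalg)"
  shows "cop (p * q) - (linext fscale (\<lambda>(a, b). basis (p * a, b)) (cop q)
      + linext fscale (\<lambda>(a, b). basis (a, b * q)) (cop p))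
    \<in> fs.span (bilin_rels (H_forests X :: ('k, 'x forest \<Rightarrow>\<^sub>0 'k) opalg))"
proof -
  define A where "A = (H_forests X :: ('k, 'x forest \<Rightarrow>\<^sub>0 'k) opalg)"
  let ?W = "fs.span (bilin_rels A)"
  let ?E = "\<lambda>p q :: 'x forest \<Rightarrow>\<^sub>0 'k. cop (p * q) - (linext fscale (\<lambda>(a, b). basis (p * a, b)) (cop q)
      + linext fscale (\<lambda>(a, b). basis (a, b * q)) (cop p))"
  note vs = vector_space_fscale and W = fs.subspace_span[of "bilin_rels A"]
  have uA: "unitary_algebra A" unfolding A_def by (rule unitary_algebra_H_forests)
  have sA: "scal A = fscale" by (simp add: A_def)
  have k: "x \<in> carr A \<and> y \<in> carr A" if "(x, y) \<in> Poly_Mapping.keys (cop r)" "r \<in> carr A" for x y r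
    using keys_cop[of r X] that unfolding A_def by blast
  note mult = unitary_algebraD(3)[OF uA] unitary_algebraD(4,5)[OF uA, symmetric]
  have lin_p: "linear_modulo A fscale ?W (\<lambda>p. ?E p q)" if q: "q \<in> carr A" for q
  proof (intro linear_modulo_diff[OF vs W] linear_modulo_add[OF vs W])
    show "linear_modulo A fscale ?W (\<lambda>p. cop (p * q))"
      using mult q by (intro linear_modulo_exact[OF vs W])
        (auto simp: distrib_right cop_add cop_fscale sA)
    show "linear_modulo A fscale ?W (\<lambda>p. linext fscale (\<lambda>(a, b). basis (p * a, b)) (cop q))"
    proof (intro linear_modulo_linext[OF vs W]; clarify)
      fix x y assume "(x, y) \<in> Poly_Mapping.keys (cop q)"
      from k[OF this q] show "linear_modulo A fscale ?W (\<lambda>p. basis (p * x, y))"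
        unfolding linear_modulo_def by (auto simp: distrib_right mult intro!: bilin_span_basis)
    qed
    show "linear_modulo A fscale ?W (\<lambda>p. linext fscale (\<lambda>(a, b). basis (a, b * q)) (cop p))"
      by (intro linear_modulo_exact[OF vs W])
        (auto simp: cop_add cop_fscale fs.linext_add fs.linext_fscale sA)
  qed
  have lin_q: "linear_modulo A fscale ?W (?E p)" if p: "p \<in> carr A" for p
  proof (intro linear_modulo_diff[OF vs W] linear_modulo_add[OF vs W])
    show "linear_modulo A fscale ?W (\<lambda>q. cop (p * q))"
      using mult p by (intro linear_modulo_exact[OF vs W])
        (auto simp: distrib_left cop_add cop_fscale sA)
    show "linear_modulo A fscale ?W (\<lambda>q. linext fscale (\<lambda>(a, b). basis (a, b * q)) (cop p))"
    proof (intro linear_modulo_linext[OF vs W]; clarify)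
      fix x y assume "(x, y) \<in> Poly_Mapping.keys (cop p)"
      from k[OF this p] show "linear_modulo A fscale ?W (\<lambda>q. basis (x, y * q))"
        unfolding linear_modulo_def by (auto simp: distrib_left mult intro!: bilin_span_basis)
    qed
    show "linear_modulo A fscale ?W (\<lambda>q. linext fscale (\<lambda>(a, b). basis (p * a, b)) (cop q))"
      by (intro linear_modulo_exact[OF vs W])
        (auto simp: cop_add cop_fscale fs.linext_add fs.linext_fscale sA)
  qed
  have "?E (basis F) (basis G) = 0" for F G
    by (simp add: basis_times_basis fs.linext_cop_forest)
      (simp add: cop_forest_def cuts_append case_prod_unfold comp_def)
  then have E0: "?E (basis F) (basis G) \<in> ?W" for F G
    using fs.span_zero by metis
  have E1: "?E (basis F) r \<in> ?W" if F: "F \<in> forests X" and r: "r \<in> carr A" for F r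
  proof (rule linear_modulo_H_forests_induct[where G = "?E (basis F)" and X = X and p = r, OF vs W _ E0])
    show "linear_modulo (H_forests X) fscale ?W (?E (basis F))"
      using lin_q[of "basis F"] F by (simp add: A_def)
    show "r \<in> carr (H_forests X :: ('k, 'x forest \<Rightarrow>\<^sub>0 'k) opalg)"
      using r unfolding A_def .
  qed
  have "?E p q \<in> ?W"
  proof (rule linear_modulo_H_forests_induct[where G = "\<lambda>p. ?E p q" and X = X and p = p, OF vs W _ E1 p])
    show "linear_modulo (H_forests X) fscale ?W (\<lambda>p. ?E p q)"
      using lin_p[of q] q by (simp add: A_def)
    show "q \<in> carr A"
      using q unfolding A_def .
  qed
  then show ?thesis by (simp add: A_def)
qed

text \<open>The defect vanishes on forests by the clause of \<open>cuts\<close> for a root decorated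
  by \<sigma>; the symbol \<open>basis (p, 1)\<close> makes it linear only modulo relations.\<close>

lemma cop_Bplus:
  fixes p :: "'x forest \<Rightarrow>\<^sub>0 'k::field"
  assumes p: "p \<in> carr (H_forests X :: ('k, 'x forest \<Rightarrow>\<^sub>0 'k) opalg)"
  shows "cop (Bplus p) - (basis (p, 1) + linext fscale (\<lambda>(a, b). basis (a, Bplus b)) (cop p))
    \<in> fs.span (bilin_rels (H_forests X :: ('k, 'x forest \<Rightarrow>\<^sub>0 'k) opalg))"
proof (rule linear_modulo_H_forests_induct[OF vector_space_fscale fs.subspace_span _ _ p])
  let ?A = "H_forests X :: ('k, 'x forest \<Rightarrow>\<^sub>0 'k) opalg"
  let ?W = "fs.span (bilin_rels ?A)"
  note vs = vector_space_fscale and W = fs.subspace_span[of "bilin_rels ?A"]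
  show "linear_modulo ?A fscale ?W
    (\<lambda>p. cop (Bplus p) - (basis (p, 1) + linext fscale (\<lambda>(a, b). basis (a, Bplus b)) (cop p)))"
  proof (intro linear_modulo_diff[OF vs W] linear_modulo_add[OF vs W])
    show "linear_modulo ?A fscale ?W (\<lambda>p. cop (Bplus p))"
      "linear_modulo ?A fscale ?W (\<lambda>p. linext fscale (\<lambda>(a, b). basis (a, Bplus b)) (cop p))"
      by (intro linear_modulo_exact[OF vs W];
          simp add: Bplus_def fs.linext_add fs.linext_fscale cop_add cop_fscale)+
    show "linear_modulo ?A fscale ?W (\<lambda>p. basis (p, 1))"
      using unitary_algebraD(2)[OF unitary_algebra_H_forests[of X]]
      unfolding linear_modulo_def by (blast intro: bilin_span_basis)
  qed
  show "cop (Bplus (basis F)) - (basis (basis F, 1)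
      + linext fscale (\<lambda>(a, b). basis (a, Bplus b)) (cop (basis F))) \<in> ?W" for F
    by (simp add: fs.linext_cop_forest)
      (simp add: cop_forest_def one_eq_basis case_prod_unfold comp_def fs.span_zero)
qed

lemma coassociative_H_forests:
  "coassociative_coalgebra (H_forests X :: ('k::field, 'x forest \<Rightarrow>\<^sub>0 'k) opalg)"
proof -
  let ?A = "H_forests X :: ('k, 'x forest \<Rightarrow>\<^sub>0 'k) opalg"
  have D: "comult ?A a = cls2 ?A (cop a)" if "a \<in> carr ?A" for a
    using Delta_eps_eq[OF that] by simp
  have mem: "a + b \<in> carr ?A" "fscale c a \<in> carr ?A" if "a \<in> carr ?A" "b \<in> carr ?A" for a b c
    using linear_spaceD(3,4)[OF linear_space_H_forests[of X]] that by simp_all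
  have "comult_id ?A (cls2 ?A (cop a)) = id_comult ?A (cls2 ?A (cop a))" if a: "a \<in> carr ?A" for a
  proof -
    have scal: "cop (scal ?A c b) = fscale c (cop b)" for c b
      by (simp add: cop_fscale)
    note on = comult_on_cls2[where D = cop, OF linear_space_H_forests keys_cop[OF a] D keys_cop
        cop_add scal]
    \<comment> \<open>An equality of formal sums, before cosets are taken: every triple that occurs
      consists of basis vectors.\<close>
    have "linext fscale (\<lambda>(a, b). linext fscale (\<lambda>(x, y). basis (x, y, b)) (cop a)) (cop_forest F) =
        linext fscale (\<lambda>(a, b). linext fscale (\<lambda>(x, y). basis (a, x, y)) (cop b)) (cop_forest F :: _ \<Rightarrow>\<^sub>0 'k)"
      for F :: "'x forest"
      using cuts_coassoc[of "\<lambda>a b c. basis (basis a, basis b, basis c)" F]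
      unfolding fs.linext_cop_forest cop_basis by (simp add: case_prod_unfold)
    then have "linext fscale (\<lambda>(a, b). linext fscale (\<lambda>(x, y). basis (x, y, b)) (cop a)) (cop a) =
        linext fscale (\<lambda>(a, b). linext fscale (\<lambda>(x, y). basis (a, x, y)) (cop b)) (cop a)"
      unfolding cop_def[THEN fun_cong, of a] fs.linext_linext by simp
    then show ?thesis
      by (simp only: on)
  qed
  then show ?thesis
    unfolding coassociative_coalgebra_def
    using mem
    by (auto intro!: imageI keys_cop simp: D tadd_cls2 tscale_cls2 cop_add cop_fscale tensor2_carr_def
        simp del: H_forests_simps(1,3))
qed

lemma eps_bialgebra_H_forests:
  "eps_bialgebra (H_forests X :: ('k::field, 'x forest \<Rightarrow>\<^sub>0 'k) opalg)"
proof -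
  let ?A = "H_forests X :: ('k, 'x forest \<Rightarrow>\<^sub>0 'k) opalg"
  note uA = unitary_algebra_H_forests[of X]
  have D: "comult ?A a = cls2 ?A (cop a)" if "a \<in> carr ?A" for a
    using Delta_eps_eq[OF that] by simp
  have "comult ?A (a * b) = tadd ?A (lact ?A a (comult ?A b)) (ract ?A (comult ?A a) b)"
    if "a \<in> carr ?A" "b \<in> carr ?A" for a b
    using cop_mult[OF that]
    by (simp only: D that unitary_algebraD(3)[OF uA] lact_cls2[OF uA] ract_cls2[OF uA] tadd_cls2
        cls2_eq_iff)
  then show ?thesis
    unfolding eps_bialgebra_def using uA coassociative_H_forests by blast
qed

text \<open>One-sided antipodes are defined by recursion on the number of vertices, which the coproduct
  lowers; they agree by uniqueness of circular inverses.\<close>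

function right_antipode :: "'x forest \<Rightarrow> ('x forest \<Rightarrow>\<^sub>0 'k::field)"
  where "right_antipode F = - basis F - (\<Sum>p\<leftarrow>cuts F. basis (fst p) * right_antipode (snd p))"
  by auto
termination
  by (relation "measure (size_list size)") (auto dest: size_cuts)

function left_antipode :: "'x forest \<Rightarrow> ('x forest \<Rightarrow>\<^sub>0 'k::field)"
  where "left_antipode F = - basis F - (\<Sum>p\<leftarrow>cuts F. left_antipode (fst p) * basis (snd p))"
  by auto
termination
  by (relation "measure (size_list size)") (auto dest: size_cuts)

declare right_antipode.simps [simp del] left_antipode.simps [simp del]

lemma antipodes_carr:
  fixes X :: "'x set"
  defines "A \<equiv> (H_forests X :: ('k::field, 'x forest \<Rightarrow>\<^sub>0 'k) opalg)"
  assumes "F \<in> forests X"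
  shows "right_antipode F \<in> carr A" "left_antipode F \<in> carr A"
proof -
  have sub: "fs.subspace (carr A)" by (simp add: A_def subspace_keys_subset)
  have mult: "p * q \<in> carr A" if "p \<in> carr A" "q \<in> carr A" for p q
    using unitary_algebraD(3)[OF unitary_algebra_H_forests] that unfolding A_def .
  have basis: "basis G \<in> carr A" if "G \<in> forests X" for G
    using that by (simp add: A_def)
  have sum: "(\<Sum>x\<leftarrow>xs. f x) \<in> carr A" if "\<And>x. x \<in> set xs \<Longrightarrow> f x \<in> carr A"
    for xs and f :: "'x forest \<times> 'x forest \<Rightarrow> _"
    using that by (induction xs) (auto intro: fs.subspace_0[OF sub] fs.subspace_add[OF sub])
  note intros = fs.subspace_diff[OF sub] fs.subspace_neg[OF sub] sum mult basis
  show "right_antipode F \<in> carr A"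
    using assms(2)
  proof (induction F rule: right_antipode.induct)
    case (1 F)
    then show ?case unfolding right_antipode.simps[of F]
      by (intro intros 1) (auto dest: cuts_forests)
  qed
  show "left_antipode F \<in> carr A"
    using assms(2)
  proof (induction F rule: left_antipode.induct)
    case (1 F)
    then show ?case unfolding left_antipode.simps[of F]
      by (intro intros 1) (auto dest: cuts_forests)
  qed
qed

text \<open>With convolutions written as sums over cuts, the recursions of the one-sided antipodes
  become the circular inverse equations.\<close>

lemma hconv_H_forests:
  fixes X :: "'x set"
  defines "A \<equiv> (H_forests X :: ('k::field, 'x forest \<Rightarrow>\<^sub>0 'k) opalg)"
  assumes f: "linear_hom A A f" and g: "linear_hom A A g" and p: "p \<in> carr A"
  shows "hconv A A f g p = linext fscale (\<lambda>F. \<Sum>q\<leftarrow>cuts F. f (basis (fst q)) * g (basis (snd q))) p"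
proof -
  have uA: "unitary_algebra A" unfolding A_def by (rule unitary_algebra_H_forests)
  have sA: "scal A = fscale" by (simp add: A_def)
  have "comult A p = cls2 A (cop p)"
    using Delta_eps_eq p unfolding A_def by simp
  then have "hconv A A f g p = linext fscale (\<lambda>(x, y). f x * g y) (cop p)"
    using linext_rep_cls2[OF vector_space_fscale bilinear_modulo_mult[OF uA f g, unfolded sA]]
    by (simp add: hconv_def sA)
  then show ?thesis
    unfolding cop_def fs.linext_linext fs.linext_cop_forest by (simp add: case_prod_unfold)
qed

lemma eps_hopf_algebra_H_forests:
  "eps_hopf_algebra (H_forests X :: ('k::field, 'x forest \<Rightarrow>\<^sub>0 'k) opalg)"
proof -
  define A where "A = (H_forests X :: ('k, 'x forest \<Rightarrow>\<^sub>0 'k) opalg)"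
  let ?R = "linext fscale right_antipode :: _ \<Rightarrow> 'x forest \<Rightarrow>\<^sub>0 'k"
  let ?L = "linext fscale left_antipode :: _ \<Rightarrow> 'x forest \<Rightarrow>\<^sub>0 'k"
  have A: "eps_bialgebra A" unfolding A_def by (rule eps_bialgebra_H_forests)
  have R: "linear_hom A A ?R" and L: "linear_hom A A ?L"
    using linear_hom_linext_fscale[OF linear_space_H_forests antipodes_carr(1), of X]
      linear_hom_linext_fscale[OF linear_space_H_forests antipodes_carr(2), of X]
    by (simp_all add: A_def)
  have 1: "hconv A A (\<lambda>x. x) ?R a + a + ?R a = 0" if "a \<in> carr A" for a
  proof -
    \<comment> \<open>The recursion was obtained by solving this equation at a single forest for the
      value of the antipode.\<close>
    have "hconv A A (\<lambda>x. x) ?R a = linext fscale (\<lambda>F. - basis F - right_antipode F) a"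
      unfolding A_def hconv_H_forests[OF linear_hom_id R[unfolded A_def] that[unfolded A_def]]
      by (subst right_antipode.simps) simp
    then show ?thesis by (simp add: fs.linext_fun_diff fs.linext_fun_uminus)
  qed
  have 2: "hconv A A ?L (\<lambda>x. x) a + ?L a + a = 0" if "a \<in> carr A" for a
  proof -
    have "hconv A A ?L (\<lambda>x. x) a = linext fscale (\<lambda>F. - basis F - left_antipode F) a"
      unfolding A_def hconv_H_forests[OF L[unfolded A_def] linear_hom_id that[unfolded A_def]]
      by (subst left_antipode.simps) simp
    then show ?thesis by (simp add: fs.linext_fun_diff fs.linext_fun_uminus)
  qed
  have eq: "?L a = ?R a" if "a \<in> carr A" for a
    by (rule circular_inverse_unique[where g = ?L and h = ?R,
          OF A eps_bialgebraD(1)[OF A] linear_hom_id L R 2 1 that])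
  have "hconv A A ?R (\<lambda>x. x) a + ?R a + a = 0" if "a \<in> carr A" for a
    using 2[OF that] eq[OF that] hconv_cong[OF A that, of ?L ?R "\<lambda>x. x" "\<lambda>x. x" A] eq by simp
  then have "is_antipode A ?R"
    using R 1 by (simp add: is_antipode_def circ_conv_eq_hconv)
  then show ?thesis
    using A unfolding A_def eps_hopf_algebra_def by blast
qed

lemma cocycle_eps_hopf_algebra_H_forests:
  "cocycle_eps_hopf_algebra (H_forests X :: ('k::field, 'x forest \<Rightarrow>\<^sub>0 'k) opalg)"
proof -
  let ?A = "H_forests X :: ('k, 'x forest \<Rightarrow>\<^sub>0 'k) opalg"
  have D: "comult ?A a = cls2 ?A (cop a)" if "a \<in> carr ?A" for a
    using Delta_eps_eq[OF that] by simp
  have op: "oper ?A = Bplus" by simp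
  have "comult ?A (Bplus a) = tadd ?A (pure ?A a 1) (tmap ?A (\<lambda>x. x) Bplus (comult ?A a))"
    if "a \<in> carr ?A" for a
    using cop_Bplus[OF that]
    by (simp only: D that linear_homD(1)[OF linear_hom_Bplus] pure_def tadd_cls2
        tmap_cls2[OF linear_hom_id linear_hom_Bplus] cls2_eq_iff)
  then show ?thesis
    unfolding cocycle_eps_hopf_algebra_def operated_eps_hopf_algebra_def op
    using eps_hopf_algebra_H_forests linear_hom_Bplus by blast
qed

section \<open>The universal property\<close>

text \<open>These values are forced on decorated forests by \<open>f\<close>, by multiplicativity
  and by compatibility with the operators; \<open>us\<close> is empty there.\<close>

fun eval_forest :: "('x \<Rightarrow> 'h::monoid_mult) \<Rightarrow> ('h \<Rightarrow> 'h) \<Rightarrow> 'x forest \<Rightarrow> 'h" where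
  "eval_forest f P [] = 1"
| "eval_forest f P (Node (Some x) us # ts) = f x * eval_forest f P ts"
| "eval_forest f P (Node None F # ts) = P (eval_forest f P F) * eval_forest f P ts"

lemma eval_forest_append:
  "eval_forest f P (F @ G) = eval_forest f P F * eval_forest f P G"
  by (induction f P F rule: eval_forest.induct) (simp_all add: mult.assoc)

lemma eval_forest_carr:
  assumes "unitary_algebra H" "f \<in> X \<rightarrow> carr H" "linear_hom H H P" "F \<in> forests X"
  shows "eval_forest f P F \<in> carr H"
  using assms(4)
  by (induction F rule: cuts.induct)
    (use assms(1-3) in \<open>auto intro: unitary_algebraD(2,3) linear_homD(1)\<close>)

section \<open>Coproducts of evaluated forests in the target\<close>

lemma comult_one:
  assumes "eps_bialgebra H"
  shows "comult H 1 = cls2 H 0"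
proof -
  note uH = eps_bialgebraD(1)[OF assms]
  have 1: "1 \<in> carr H" by (rule unitary_algebraD(2)[OF uH])
  let ?t = "rep (comult H 1)"
  have t: "comult H 1 = cls2 H ?t"
    using cls2_rep coalgebraD(1)[OF eps_bialgebraD(2)[OF assms] 1] by metis
  \<comment> \<open>The derivation rule at \<open>1 * 1\<close> makes the coproduct of the unit
    equal to its double, hence zero.\<close>
  have "comult H 1 = tadd H (lact H 1 (comult H 1)) (ract H (comult H 1) 1)"
    using eps_bialgebraD(4)[OF assms 1 1] by simp
  also have "\<dots> = cls2 H (?t + ?t)"
    by (subst (1 2) t) (simp add: lact_cls2[OF uH 1] ract_cls2[OF uH 1] tadd_cls2 case_prod_unfold)
  finally have "cls2 H (?t + ?t) = cls2 H ?t" using t by simp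
  then have "?t \<in> fs.span (bilin_rels H)" by (simp add: cls2_eq_iff)
  then show ?thesis using t cls2_zero by metis
qed

text \<open>The counterpart of \<open>linear_hom_linext\<close> for a map into cosets, where
  addition and scaling are \<open>tadd\<close> and \<open>tscale\<close> instead of type class
  operations.\<close>

lemma comult_linext:
  assumes H: "eps_bialgebra H"
    and g: "\<And>k. k \<in> Poly_Mapping.keys p \<Longrightarrow> g k \<in> carr H \<and> comult H (g k) = cls2 H (d k)"
  shows "comult H (linext (scal H) g p) = cls2 H (linext fscale d p)"
proof -
  note lH = linear_spaceD[OF eps_bialgebraD(3)[OF H]]
    and cH = coalgebraD[OF eps_bialgebraD(2)[OF H]]
  interpret vector_space "scal H" by (rule lH(1))
  have 0: "comult H 0 = cls2 H 0"
    using cH(3)[OF lH(2), of 0] by (simp add: tscale_def)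
  have "(\<Sum>k\<in>K. scal H (c k) (g k)) \<in> carr H \<and>
      comult H (\<Sum>k\<in>K. scal H (c k) (g k)) = cls2 H (\<Sum>k\<in>K. fscale (c k) (d k))"
    if "finite K" "K \<subseteq> Poly_Mapping.keys p" for K c
    using that
  proof induction
    case empty
    then show ?case by (simp add: lH(2) 0)
  next
    case (insert k K)
    then have "g k \<in> carr H" "comult H (g k) = cls2 H (d k)" using g by blast+
    with insert show ?case by (simp add: lH(3,4) cH(2,3) tscale_cls2 tadd_cls2)
  qed
  from this[OF finite_keys order_refl] show ?thesis by (simp add: linext_def)
qed

lemma comult_eval_forest:
  fixes H :: "('k::field, 'h::{ring,monoid_mult}) opalg"
  assumes H: "cocycle_eps_hopf_algebra H" and f: "f \<in> X \<rightarrow> carr H"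
    and fX: "\<forall>x\<in>X. comult H (f x) = pure H 1 1" and F: "F \<in> forests X"
  shows "comult H (eval_forest f (oper H) F) =
    cls2 H (\<Sum>(a, b)\<leftarrow>cuts F. basis (eval_forest f (oper H) a, eval_forest f (oper H) b))"
proof -
  have bH: "eps_bialgebra H" and P: "linear_hom H H (oper H)"
    using H by (simp_all add: cocycle_eps_hopf_algebra_def operated_eps_hopf_algebra_def
        eps_hopf_algebra_def)
  note uH = eps_bialgebraD(1)[OF bH]
  note carr = eval_forest_carr[OF uH f P]
  let ?e = "eval_forest f (oper H)"
  have mult: "comult H (a * b) = cls2 H
      (linext fscale (\<lambda>(x, y). basis (a * x, y)) u + linext fscale (\<lambda>(x, y). basis (x, y * b)) t)"
    if "a \<in> carr H" "b \<in> carr H" "comult H a = cls2 H t" "comult H b = cls2 H u" for a b t u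
    using that eps_bialgebraD(4)[OF bH that(1,2)]
    by (simp add: lact_cls2[OF uH] ract_cls2[OF uH] tadd_cls2)
  show ?thesis
    using F
  proof (induction F rule: cuts.induct)
    case 1
    then show ?case by (simp add: comult_one[OF bH])
  next
    case (2 x us ts)
    then have x: "x \<in> X" "us = []" and ts: "ts \<in> forests X" by simp_all
    have "comult H (f x) = cls2 H (basis (1, 1))" using fX x by (simp add: pure_def)
    from mult[OF _ carr[OF ts] this "2.IH"[OF ts]] f x show ?case
      by (auto simp: fs.linext_sum_list case_prod_unfold comp_def add.commute)
  next
    case (3 F ts)
    then have F: "F \<in> forests X" and ts: "ts \<in> forests X" by simp_all
    have "comult H (oper H (?e F)) = cls2 H
        (basis (?e F, 1) + linext fscale (\<lambda>(x, y). basis (x, oper H y))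
          (\<Sum>(a, b)\<leftarrow>cuts F. basis (?e a, ?e b)))"
      using H carr[OF F]
      by (simp add: cocycle_eps_hopf_algebra_def "3.IH"(1)[OF F] pure_def
          tmap_cls2[OF linear_hom_id P] tadd_cls2)
    \<comment> \<open>The cocycle condition followed by right multiplication yields the first two
      groups of entries in this clause of \<open>cuts\<close>; left multiplication by the evaluated
      first tree yields the third.\<close>
    from mult[OF linear_homD(1)[OF P carr[OF F]] carr[OF ts] this "3.IH"(2)[OF ts]] show ?case
      by (simp add: fs.linext_sum_list fs.linext_add case_prod_unfold comp_def add.commute
          add.left_commute)
  qed
qed

theorem theorem3p12:
  fixes X :: "'x set"
  shows "free_cocycle_eps_hopf_algebra TYPE('h::{ring,monoid_mult}) X
           (H_forests X :: ('k::field_char_0, 'x forest \<Rightarrow>\<^sub>0 'k) opalg) bullet"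
  unfolding free_cocycle_eps_hopf_algebra_def
proof (intro conjI allI impI)
  let ?A = "H_forests X :: ('k, 'x forest \<Rightarrow>\<^sub>0 'k) opalg"
  show cA: "cocycle_eps_hopf_algebra ?A"
    by (rule cocycle_eps_hopf_algebra_H_forests)
  show bullet: "bullet \<in> X \<rightarrow> carr ?A"
    by (auto simp: bullet_def)
  fix H :: "('k, 'h) opalg" and f
  assume "cocycle_eps_hopf_algebra H \<and> f \<in> X \<rightarrow> carr H \<and> (\<forall>x\<in>X. comult H (f x) = pure H 1 1)"
  then have cH: "cocycle_eps_hopf_algebra H" and f: "f \<in> X \<rightarrow> carr H"
    and fX: "\<forall>x\<in>X. comult H (f x) = pure H 1 1" by blast+
  have hH: "eps_hopf_algebra H" and bH: "eps_bialgebra H" and P: "linear_hom H H (oper H)"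
    using cH by (simp_all add: cocycle_eps_hopf_algebra_def operated_eps_hopf_algebra_def
        eps_hopf_algebra_def)
  note uH = eps_bialgebraD(1)[OF bH] and lH = eps_bialgebraD(3)[OF bH]
  interpret vector_space "scal H" by (rule linear_spaceD(1)[OF lH])
  let ?e = "eval_forest f (oper H)"
  note e_carr = eval_forest_carr[OF uH f P]
  note uA = unitary_algebra_H_forests[of X]
  define \<psi> where "\<psi> = linext (scal H) ?e"
  define \<phi> where "\<phi> = restrict \<psi> (carr ?A)"
  have \<phi>: "\<phi> p = linext (scal H) ?e p" if "p \<in> carr ?A" for p
    using that by (simp add: \<phi>_def \<psi>_def)
  have \<phi>_basis: "\<phi> (basis F) = ?e F" if "F \<in> forests X" for F
    using that by (simp add: \<phi>)
  have basis_carr: "basis F \<in> carr ?A" if "F \<in> forests X" for F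
    using that by simp
  have keysD: "F \<in> forests X" if "F \<in> Poly_Mapping.keys p" "p \<in> carr ?A" for F p
    using that by auto
  have lin: "linear_hom ?A H \<phi>"
    unfolding \<phi>_def \<psi>_def
    by (intro linear_hom_restrict linear_space_H_forests linear_hom_linext_fscale lH e_carr)
  have mult: "\<phi> (p * q) = \<phi> p * \<phi> q" if p: "p \<in> carr ?A" and q: "q \<in> carr ?A" for p q
  proof -
    have "\<phi> (p * q) = linext (scal H) (\<lambda>F. linext (scal H) (\<lambda>G. ?e F * ?e G) q) p"
      unfolding \<phi>[OF unitary_algebraD(3)[OF uA p q]] unfolding times_eq_linext linext_linext
      by (simp add: eval_forest_append)
    also have "\<dots> = linext (scal H) (\<lambda>F. ?e F * \<phi> q) p"
      unfolding \<phi>[OF q] using p q keysD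
      by (intro linext_cong refl linext_mult_left[OF uH, symmetric] e_carr) blast+
    also have "\<dots> = \<phi> p * \<phi> q"
      unfolding \<phi>[OF p] using p keysD linear_homD(1)[OF lin q]
      by (intro linext_mult_right[OF uH, symmetric] e_carr) blast+
    finally show ?thesis .
  qed
  have comult: "comult H (\<phi> p) = tmap H \<phi> \<phi> (comult ?A p)" if p: "p \<in> carr ?A" for p
  proof -
    have "comult H (\<phi> p) = cls2 H (linext fscale (\<lambda>F. \<Sum>(a, b)\<leftarrow>cuts F. basis (?e a, ?e b)) p)"
      unfolding \<phi>[OF p] using keysD[OF _ p] e_carr comult_eval_forest[OF cH f fX]
      by (intro comult_linext[OF bH]) blast
    \<comment> \<open>Both parts of a cut are again decorated forests, so their evaluations are
      values of \<phi> and the sum takes the form of \<open>tmap\<close> applied to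
      \<open>cop\<close>.\<close>
    also have "linext fscale (\<lambda>F. \<Sum>(a, b)\<leftarrow>cuts F. basis (?e a, ?e b)) p =
        linext fscale (\<lambda>F. \<Sum>(a, b)\<leftarrow>cuts F. basis (\<phi> (basis a), \<phi> (basis b))) p"
      by (intro linext_cong refl arg_cong[where f = sum_list] map_cong)
        (auto simp: \<phi>_basis dest!: keysD[OF _ p] dest: cuts_forests)
    also have "cls2 H \<dots> = tmap H \<phi> \<phi> (comult ?A p)"
      unfolding H_forests_simps Delta_eps_eq[OF p] tmap_cls2[OF lin lin] cop_def
        fs.linext_linext fs.linext_cop_forest ..
    finally show ?thesis .
  qed
  have one: "\<phi> 1 = 1"
    using \<phi>_basis[of "[]"] by (simp add: one_eq_basis)
  have hA: "eps_hopf_algebra ?A" by (rule eps_hopf_algebra_H_forests)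
  have "eps_bialgebra_morphism ?A H \<phi>"
    using lin one mult comult unfolding eps_bialgebra_morphism_def by blast
  then have "eps_hopf_morphism ?A H \<phi>" by (rule eps_hopf_morphismI[OF hA hH])
  moreover have "\<phi> (oper ?A p) = oper H (\<phi> p)" if p: "p \<in> carr ?A" for p
  proof -
    have "oper H (\<phi> p) = linext (scal H) (\<lambda>F. oper H (?e F)) p"
      unfolding \<phi>[OF p] by (intro linear_hom_linext[OF lH lH P] e_carr keysD[OF _ p])
    moreover have "\<phi> (Bplus p) = linext (scal H) (\<lambda>F. oper H (?e F)) p"
      unfolding \<phi>[OF linear_homD(1)[OF linear_hom_Bplus p]] unfolding Bplus_def linext_linext by simp
    ultimately show ?thesis by simp
  qed
  ultimately have mor: "operated_eps_hopf_morphism ?A H \<phi>"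
    unfolding operated_eps_hopf_morphism_def by blast
  show "\<exists>!\<phi>. \<phi> \<in> extensional (carr ?A) \<and> operated_eps_hopf_morphism ?A H \<phi> \<and> (\<forall>x\<in>X. \<phi> (bullet x) = f x)"
  proof (rule ex1I[of _ \<phi>])
    show "\<phi> \<in> extensional (carr ?A) \<and> operated_eps_hopf_morphism ?A H \<phi> \<and> (\<forall>x\<in>X. \<phi> (bullet x) = f x)"
      using mor \<phi>_basis by (auto simp: \<phi>_def bullet_def simp del: H_forests_simps)
    fix \<theta>
    assume \<theta>: "\<theta> \<in> extensional (carr ?A) \<and> operated_eps_hopf_morphism ?A H \<theta> \<and> (\<forall>x\<in>X. \<theta> (bullet x) = f x)"
    then have bm: "eps_bialgebra_morphism ?A H \<theta>" and \<theta>P: "\<And>p. p \<in> carr ?A \<Longrightarrow> \<theta> (Bplus p) = oper H (\<theta> p)"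
      by (auto simp: operated_eps_hopf_morphism_def eps_hopf_morphism_def)
    then have \<theta>lin: "linear_hom ?A H \<theta>" and \<theta>1: "\<theta> 1 = 1"
      and \<theta>mult: "\<And>p q. p \<in> carr ?A \<Longrightarrow> q \<in> carr ?A \<Longrightarrow> \<theta> (p * q) = \<theta> p * \<theta> q"
      unfolding eps_bialgebra_morphism_def by blast+
    \<comment> \<open>A forest is the product of its trees, and a tree is a bullet or a grafting. So
      multiplicativity, the values on bullets and compatibility with \<open>Bplus\<close> determine
      \<theta> on forests, hence by linearity on the carrier.\<close>
    have \<theta>_Cons: "\<theta> (basis (t # ts)) = \<theta> (basis [t]) * \<theta> (basis ts)"
      if "leaf_decorated X t" "ts \<in> forests X" for t ts
      using \<theta>mult[of "basis [t]" "basis ts"] that by (simp add: basis_times_basis)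
    have "\<theta> (basis F) = ?e F" if "F \<in> forests X" for F
      using that
    proof (induction F rule: cuts.induct)
      case 1
      then show ?case using \<theta>1 by (simp add: one_eq_basis)
    next
      case (2 x us ts)
      then show ?case using \<theta> \<theta>_Cons[of "Node (Some x) us" ts] by (simp add: bullet_def)
    next
      case (3 F ts)
      then show ?case using \<theta>P[of "basis F"] \<theta>_Cons[of "Node None F" ts] by simp
    qed
    then have eq: "linext (scal H) (\<lambda>F. \<theta> (basis F)) p = \<phi> p" if p: "p \<in> carr ?A" for p
      unfolding \<phi>[OF p] using keysD[OF _ p] by (intro linext_cong) auto
    have "\<theta> p = \<phi> p" if p: "p \<in> carr ?A" for p
      using linear_hom_linext[OF linear_space_H_forests lH \<theta>lin, of p basis] keysD[OF _ p] eq[OF p]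
      by simp
    then show "\<theta> = \<phi>"
      using \<theta> by (intro extensionalityI[of _ "carr ?A"]) (auto simp: \<phi>_def)
  qed
qed

end
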